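(* The $\mathfrak{vect}(1)$-module $\mathcal{S}^3_4=\mathcal{F}_4\oplus\mathcal{F}_3\oplus\mathcal{F}_2\oplus\mathcal{F}_1$ admits eight different formal deformations with four independent parameters. They are all equivalent to infinitesimal ones (i.e. to deformations of the form $L_X+\mathcal{L}_X^{(1)}$, of degree 1 in the parameters).
   Context: $\mathfrak{vect}(1)$ is the Lie algebra of polynomial vector fields $X\frac{d}{dx}$, $X\in\mathbb{R}[x]$. $\mathcal{F}_\lambda=\{f\,dx^\lambda: f\in\mathbb{R}[x]\}$ with action $L^\lambda_X(f)=Xf'+\lambda X'f$; $L_X$ is the resulting action on $\mathcal{S}^3_4$. Define (extended by $0$ to $\mathcal{S}^3_4$) $C_{\lambda,\lambda}(X)(f)=X'f$, $C_{\lambda,\lambda+2}(X)(f)=X^{(3)}f+2X''f'$, $C_{\lambda,\lambda+3}(X)(f)=X^{(3)}f'+X''f''$, as maps $\mathcal{F}_\lambda\to\mathcal{F}_{\lambda+k}$, $k=0,2,3$. The general infinitesimal deformation of $\mathcal{S}^3_4$ is $L_X+\mathcal{L}^{(1)}_X$, with $$\mathcal{L}_X^{(1)}=t_{1,1}C_{1,1}(X)+t_{1,3}C_{1,3}(X)+t_{1,4}C_{1,4}(X)+t_{2,2}C_{2,2}(X)+t_{2,4}C_{2,4}(X)+t_{3,3}C_{3,3}(X)+t_{4,4}C_{4,4}(X).$$ A formal deformation is a formal series $\mathcal{L}_X=L_X+\mathcal{L}_X^{(1)}+\mathcal{L}_X^{(2)}+\cdots$, with $\mathcal{L}^{(m)}$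 homogeneous of degree $m$ in the parameters with values in differential operators on $\mathcal{S}^3_4$, satisfying $[\mathcal{L}_X,\mathcal{L}_Y]=\mathcal{L}_{[X,Y]}$ in every order. A formal deformation "with four independent parameters" is one in which linear relations are imposed on the seven parameters of $\mathcal{L}^{(1)}$ leaving four independent; two such are "different" if they correspond to different sets of linear relations (different linear subspaces of the parameter space). Two deformations with the same base algebra $\mathcal{A}$ (a quotient of the power series ring in the parameters) are equivalent if they are conjugate under an inner automorphism $\Psi$ of the associative algebra $\mathrm{End}(\mathcal{S}^3_4)\otimes\mathcal{A}$ with $\Psi(\mathbb{I})=\mathbb{I}$.
   Formalization: Equivalence to an infinitesimal deformation is stated up to a formal change of the parameters t → t+O(t²) preserving the linear relations; with the parameters fixed it fails, e.g. for L+L^(1)+t_{2,2}² C_{1,1} over t_{1,3}=t_{1,4}=t_{2,4}=0. *)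

theory Defs
  imports "HOL-Analysis.Analysis" "HOL-Computational_Algebra.Polynomial"
begin

section \<open>The module of symbols\<close>

text \<open>
  The polynomial vector field \<open>X d/dx\<close> is represented by the polynomial \<open>X\<close>, and
  \<open>f dx\<^sup>\<lambda>\<close> by the polynomial \<open>f\<close>.
\<close>

definition vf_bracket :: "real poly \<Rightarrow> real poly \<Rightarrow> real poly" where
  "vf_bracket X Y = X * pderiv Y - pderiv X * Y"

definition Lie_density :: "real \<Rightarrow> real poly \<Rightarrow> real poly \<Rightarrow> real poly" where
  "Lie_density l X f = X * pderiv f + smult l (pderiv X * f)"

text \<open>\<open>W\<^sub>i\<close> labels the summand of densities of weight \<open>i\<close>.\<close>

datatype comp = W1 | W2 | W3 | W4

instance comp :: finite
proof
  have "(UNIV :: comp set) = {W1, W2, W3, W4}"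
    using comp.exhaust by auto
  then show "finite (UNIV :: comp set)"
    by (metis finite.emptyI finite.insertI)
qed

fun weight :: "comp \<Rightarrow> real" where
  "weight W1 = 1"
| "weight W2 = 2"
| "weight W3 = 3"
| "weight W4 = 4"

type_synonym S34 = "real poly ^ comp"

definition scaleS :: "real \<Rightarrow> S34 \<Rightarrow> S34" where
  "scaleS c u = (\<chi> i. smult c (u $ i))"

definition Lie_S :: "real poly \<Rightarrow> S34 \<Rightarrow> S34" where
  "Lie_S X u = (\<chi> i. Lie_density (weight i) X (u $ i))"

definition EndS :: "(S34 \<Rightarrow> S34) set" where
  "EndS = {P. (\<forall>u v. P (u + v) = P u + P v) \<and> (\<forall>c u. P (scaleS c u) = scaleS c (P u))}"

definition diff_op :: "(real poly \<Rightarrow> real poly) \<Rightarrow> bool" where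
  "diff_op P \<longleftrightarrow> (\<exists>(n::nat) a. \<forall>f. P f = (\<Sum>k\<le>n. a k * (pderiv ^^ k) f))"

definition DiffS :: "(S34 \<Rightarrow> S34) set" where
  "DiffS = {P. \<exists>A. (\<forall>i j. diff_op (A i j)) \<and> (\<forall>u. P u = (\<chi> i. \<Sum>j\<in>UNIV. A i j (u $ j)))}"


section \<open>The general infinitesimal deformation\<close>

text \<open>The expressions of the cocycles \<open>C\<^bsub>\<lambda>,\<lambda>+k\<^esub>\<close>, for \<open>k = 0, 2, 3\<close>, do not involve \<open>\<lambda>\<close>.\<close>

definition C0 :: "real poly \<Rightarrow> real poly \<Rightarrow> real poly" where
  "C0 X f = pderiv X * f"

definition C2 :: "real poly \<Rightarrow> real poly \<Rightarrow> real poly" where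
  "C2 X f = (pderiv ^^ 3) X * f + smult 2 ((pderiv ^^ 2) X * pderiv f)"

definition C3 :: "real poly \<Rightarrow> real poly \<Rightarrow> real poly" where
  "C3 X f = (pderiv ^^ 3) X * pderiv f + (pderiv ^^ 2) X * (pderiv ^^ 2) f"

definition ext0 :: "comp \<Rightarrow> comp \<Rightarrow> (real poly \<Rightarrow> real poly) \<Rightarrow> S34 \<Rightarrow> S34" where
  "ext0 i j P u = (\<chi> k. if k = j then P (u $ i) else 0)"

text \<open>The index \<open>T\<^sub>i\<^sub>j\<close> stands for the parameter \<open>t\<^bsub>i,j\<^esub>\<close>; the parameter space is
  \<open>real ^ par\<close>.\<close>

datatype par = T11 | T13 | T14 | T22 | T24 | T33 | T44

instance par :: finite
proof
  have "(UNIV :: par set) = {T11, T13, T14, T22, T24, T33, T44}"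
    using par.exhaust by auto
  then show "finite (UNIV :: par set)"
    by (metis finite.emptyI finite.insertI)
qed

definition Lie1 :: "real ^ par \<Rightarrow> real poly \<Rightarrow> S34 \<Rightarrow> S34" where
  "Lie1 t X u =
     scaleS (t $ T11) (ext0 W1 W1 (C0 X) u) + scaleS (t $ T13) (ext0 W1 W3 (C2 X) u)
   + scaleS (t $ T14) (ext0 W1 W4 (C3 X) u) + scaleS (t $ T22) (ext0 W2 W2 (C0 X) u)
   + scaleS (t $ T24) (ext0 W2 W4 (C2 X) u) + scaleS (t $ T33) (ext0 W3 W3 (C0 X) u)
   + scaleS (t $ T44) (ext0 W4 W4 (C0 X) u)"


section \<open>Formal series in the parameters\<close>

text \<open>
  Imposing linear relations on the parameters means restricting them to a linear subspace
  \<open>V\<close> of the parameter space; the base algebra \<open>A\<^sub>V\<close> is the quotient of the ring of formal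
  power series in the seven parameters by the linear forms that vanish on \<open>V\<close>. As the ground
  field is infinite, its homogeneous part of degree \<open>m\<close> is the space of functions on \<open>V\<close>
  that are given by homogeneous polynomials of degree \<open>m\<close>. A formal series with operator
  coefficients is accordingly the sequence of its homogeneous parts, each of them a function
  of the parameters. Only the values at points of \<open>V\<close> matter, and equality in the algebra of
  such series is \<open>eq_on V\<close>.
\<close>

type_synonym op_series = "nat \<Rightarrow> real ^ par \<Rightarrow> S34 \<Rightarrow> S34"

definition multi_indices :: "nat \<Rightarrow> (par \<Rightarrow> nat) set" where
  "multi_indices m = {\<alpha>. (\<Sum>i\<in>UNIV. \<alpha> i) = m}"

definition par_monom :: "(par \<Rightarrow> nat) \<Rightarrow> real ^ par \<Rightarrow> real" where
  "par_monom \<alpha> t = (\<Prod>i\<in>UNIV. (t $ i) ^ \<alpha> i)"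

definition hom_poly_op ::
  "(S34 \<Rightarrow> S34) set \<Rightarrow> (real ^ par) set \<Rightarrow> nat \<Rightarrow> (real ^ par \<Rightarrow> S34 \<Rightarrow> S34) \<Rightarrow> bool" where
  "hom_poly_op W V m P \<longleftrightarrow>
     (\<exists>c. (\<forall>\<alpha>\<in>multi_indices m. c \<alpha> \<in> W) \<and>
          (\<forall>t\<in>V. \<forall>u. P t u = (\<Sum>\<alpha>\<in>multi_indices m. scaleS (par_monom \<alpha> t) (c \<alpha> u))))"

definition hom_poly_par ::
  "(real ^ par) set \<Rightarrow> nat \<Rightarrow> (real ^ par \<Rightarrow> real ^ par) \<Rightarrow> bool" where
  "hom_poly_par V m p \<longleftrightarrow>
     (\<exists>c. \<forall>t\<in>V. p t = (\<Sum>\<alpha>\<in>multi_indices m. par_monom \<alpha> t *\<^sub>R c \<alpha>))"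

definition series_over :: "(S34 \<Rightarrow> S34) set \<Rightarrow> (real ^ par) set \<Rightarrow> op_series set" where
  "series_over W V = {P. \<forall>m. hom_poly_op W V m (P m)}"

definition eq_on :: "(real ^ par) set \<Rightarrow> op_series \<Rightarrow> op_series \<Rightarrow> bool" where
  "eq_on V P Q \<longleftrightarrow> (\<forall>m. \<forall>t\<in>V. P m t = Q m t)"

definition series_mult :: "op_series \<Rightarrow> op_series \<Rightarrow> op_series" where
  "series_mult P Q = (\<lambda>m t u. \<Sum>k\<le>m. P k t (Q (m - k) t u))"

definition series_one :: op_series where
  "series_one = (\<lambda>m t u. if m = 0 then u else 0)"

definition series_comm :: "op_series \<Rightarrow> op_series \<Rightarrow> op_series" where
  "series_comm P Q = (\<lambda>m t u. series_mult P Q m t u - series_mult Q P m t u)"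


section \<open>Formal deformations and their equivalence\<close>

definition formal_deformation :: "(real ^ par) set \<Rightarrow> (real poly \<Rightarrow> op_series) \<Rightarrow> bool" where
  "formal_deformation V D \<longleftrightarrow>
     (\<forall>X. D X \<in> series_over DiffS V) \<and>
     (\<forall>X Y m. \<forall>t\<in>V. \<forall>u. D (X + Y) m t u = D X m t u + D Y m t u) \<and>
     (\<forall>c X m. \<forall>t\<in>V. \<forall>u. D (smult c X) m t u = scaleS c (D X m t u)) \<and>
     (\<forall>X. \<forall>t\<in>V. D X 0 t = Lie_S X) \<and>
     (\<forall>X. \<forall>t\<in>V. D X 1 t = Lie1 t X) \<and>
     (\<forall>X Y. eq_on V (series_comm (D X) (D Y)) (D (vf_bracket X Y)))"

definition inner_automorphism :: "(real ^ par) set \<Rightarrow> (op_series \<Rightarrow> op_series) \<Rightarrow> bool" where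
  "inner_automorphism V \<Psi> \<longleftrightarrow>
     (\<exists>G\<in>series_over EndS V. \<exists>H\<in>series_over EndS V.
        eq_on V (series_mult G H) series_one \<and> eq_on V (series_mult H G) series_one \<and>
        (\<forall>P\<in>series_over EndS V. eq_on V (\<Psi> P) (series_mult G (series_mult P H))))"

definition equivalent_deformations ::
  "(real ^ par) set \<Rightarrow> (real poly \<Rightarrow> op_series) \<Rightarrow> (real poly \<Rightarrow> op_series) \<Rightarrow> bool" where
  "equivalent_deformations V D E \<longleftrightarrow>
     (\<exists>\<Psi>. inner_automorphism V \<Psi> \<and> eq_on V (\<Psi> series_one) series_one \<and>
          (\<forall>X. eq_on V (\<Psi> (D X)) (E X)))"

text \<open>
  A formal system of parameters on \<open>V\<close>: a formal map \<open>t + \<phi> 2 t + \<phi> 3 t + \<dots>\<close> from \<open>V\<close> to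
  \<open>V\<close>. As its linear part is the identity, substituting it is an automorphism of \<open>A\<^sub>V\<close>, and its
  components generate \<open>A\<^sub>V\<close> just as the original parameters do.
\<close>

definition parameter_system :: "(real ^ par) set \<Rightarrow> (nat \<Rightarrow> real ^ par \<Rightarrow> real ^ par) \<Rightarrow> bool" where
  "parameter_system V \<phi> \<longleftrightarrow>
     (\<forall>m. hom_poly_par V m (\<phi> m)) \<and> (\<forall>m. \<forall>t\<in>V. \<phi> m t \<in> V) \<and>
     (\<forall>t\<in>V. \<phi> 0 t = 0) \<and> (\<forall>t\<in>V. \<phi> 1 t = t)"

definition original_parameters :: "nat \<Rightarrow> real ^ par \<Rightarrow> real ^ par" where
  "original_parameters m t = (if m = 1 then t else 0)"

text \<open>
  The infinitesimal deformation \<open>L\<^sub>X + L\<^sub>X\<^sup>(\<^sup>1\<^sup>)\<close>, of degree 1 in the parameters \<open>\<phi>\<close>. Since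
  \<open>L\<^sub>X\<^sup>(\<^sup>1\<^sup>)\<close> is linear in the parameters, its part of degree \<open>m\<close> in the original parameters is
  its value at the part of degree \<open>m\<close> of \<open>\<phi>\<close>.
\<close>

definition infinitesimal_deformation ::
  "(nat \<Rightarrow> real ^ par \<Rightarrow> real ^ par) \<Rightarrow> real poly \<Rightarrow> op_series" where
  "infinitesimal_deformation \<phi> X = (\<lambda>m t. if m = 0 then Lie_S X else Lie1 (\<phi> m t) X)"

text \<open>
  The sets of linear relations that leave four independent parameters and for which there is
  a formal deformation. Formal deformations with different relations are the different ones.
\<close>

definition four_parameter_relations :: "(real ^ par) set set" where
  "four_parameter_relations = {V. subspace V \<and> dim V = 4 \<and> (\<exists>D. formal_deformation V D)}"

end

theory Submission
  imports Defs
begin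

text \<open>
  A cocycle with values in the linear maps between two density modules becomes, after subtracting
  a coboundary, invariant under translations and of weight zero under the Euler field; it is then
  given by at most three numbers, and comparing them with the \<open>C\<^bsub>\<lambda>,\<lambda>+k\<^esub>\<close> shows that these span
  the first cohomology. Given a deformation \<open>D\<close>, one looks for \<open>G = 1 + \<dots>\<close> and parameters
  \<open>\<phi>\<close> with \<open>G D = E G\<close>, where \<open>E = L + L\<^sup>(\<^sup>1\<^sup>)(\<phi>)\<close>, degree by degree. The coboundary of the
  first nonzero term of \<open>E G - G D\<close> is the first nonzero term of the curvature of \<open>E\<close>, whose
  blocks are multiples of \<open>X' C(Y) - Y' C(X)\<close>. No nonzero multiple of it is a coboundary, so
  the curvature vanishes, the error is a cocycle, and the next terms of \<open>G\<close> and \<open>\<phi>\<close> remove it.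
  The vanishing of the curvature says that three products of formal series,
  \<open>\<phi>\<^sub>1\<^sub>3 (\<phi>\<^sub>1\<^sub>1 - \<phi>\<^sub>3\<^sub>3)\<close>, \<open>\<phi>\<^sub>1\<^sub>4 (\<phi>\<^sub>1\<^sub>1 - \<phi>\<^sub>4\<^sub>4)\<close> and \<open>\<phi>\<^sub>2\<^sub>4 (\<phi>\<^sub>2\<^sub>2 - \<phi>\<^sub>4\<^sub>4)\<close>, are zero:
  choosing a factor in each gives the eight systems of relations.
\<close>

section \<open>Cohomology with values in maps of densities\<close>

definition poly_linear :: "(real poly \<Rightarrow> real poly) \<Rightarrow> bool" where
  "poly_linear P \<longleftrightarrow> (\<forall>f g. P (f + g) = P f + P g) \<and> (\<forall>c f. P (smult c f) = smult c (P f))"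

definition cochain :: "(real poly \<Rightarrow> real poly \<Rightarrow> real poly) \<Rightarrow> bool" where
  "cochain c \<longleftrightarrow> (\<forall>X. poly_linear (c X)) \<and> (\<forall>f. poly_linear (\<lambda>X. c X f))"

text \<open>Together with \<open>codiff1\<close> these are the Chevalley-Eilenberg differentials in
  degrees 0 and 1, for the action on linear maps from densities of weight \<open>l\<close> to
  densities of weight \<open>m\<close>.\<close>

definition codiff0 ::
  "real \<Rightarrow> real \<Rightarrow> (real poly \<Rightarrow> real poly) \<Rightarrow> real poly \<Rightarrow> real poly \<Rightarrow> real poly" where
  "codiff0 l m B X f = Lie_density m X (B f) - B (Lie_density l X f)"

definition codiff1 ::
  "real \<Rightarrow> real \<Rightarrow> (real poly \<Rightarrow> real poly \<Rightarrow> real poly) \<Rightarrow> real poly \<Rightarrow> real poly \<Rightarrow> real poly \<Rightarrow> real poly" where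
  "codiff1 l m c X Y f = Lie_density m X (c Y f) - c Y (Lie_density l X f)
     - (Lie_density m Y (c X f) - c X (Lie_density l Y f)) - c (vf_bracket X Y) f"

text \<open>A cocycle that vanishes on \<open>d/dx\<close> is invariant under translations, hence determined by these
  numbers.\<close>

definition gam :: "(real poly \<Rightarrow> real poly \<Rightarrow> real poly) \<Rightarrow> nat \<Rightarrow> nat \<Rightarrow> real" where
  "gam c q n = coeff (c (monom 1 q) (monom 1 n)) 0"

section \<open>Linear maps of polynomials and bilinear cochains\<close>

lemma poly_linearI:
  "(\<And>f g. P (f + g) = P f + P g) \<Longrightarrow> (\<And>c f. P (smult c f) = smult c (P f)) \<Longrightarrow> poly_linear P"
  by (simp add: poly_linear_def)

lemma
  assumes "poly_linear P"
  shows poly_linear_add: "P (f + g) = P f + P g"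
    and poly_linear_smult: "P (smult c f) = smult c (P f)"
    and poly_linear_0: "P 0 = 0"
    and poly_linear_diff: "P (f - g) = P f - P g"
proof -
  show a: "P (f + g) = P f + P g" for f g using assms by (simp add: poly_linear_def)
  show "P (smult c f) = smult c (P f)" using assms by (simp add: poly_linear_def)
  show "P 0 = 0" using a[of 0 0] by simp
  show "P (f - g) = P f - P g" using a[of "f - g" g] by simp
qed

lemma poly_linear_sum:
  assumes "poly_linear P"
  shows "P (\<Sum>i\<in>I. f i) = (\<Sum>i\<in>I. P (f i))"
  by (induction I rule: infinite_finite_induct) (simp_all add: poly_linear_0[OF assms] poly_linear_add[OF assms])

lemma smult_sum_right: "smult (c::real) (\<Sum>i\<in>I. f i) = (\<Sum>i\<in>I. smult c (f i))"
  by (induction I rule: infinite_finite_induct) (simp_all add: smult_add_right)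

lemma
  assumes "cochain c"
  shows cochain_linear: "poly_linear (c X)"
    and cochain_linear_vf: "poly_linear (\<lambda>X. c X f)"
  using assms by (simp_all add: cochain_def)

lemma poly_eq_sum_smult_monom:
  fixes f :: "real poly"
  shows "degree f \<le> N \<Longrightarrow> f = (\<Sum>n\<le>N. smult (coeff f n) (monom 1 n))"
  using poly_as_sum_of_monoms'[of f N] by (simp add: smult_monom)

lemma poly_linear_pderiv: "poly_linear pderiv"
  by (simp add: poly_linear_def pderiv_add pderiv_smult)

lemma poly_linear_Lie_density: "poly_linear (Lie_density l X)"
  by (simp add: poly_linear_def Lie_density_def pderiv_add pderiv_smult algebra_simps smult_add_right)

lemma poly_linear_Lie_density_vf: "poly_linear (\<lambda>X. Lie_density l X f)"
  by (simp add: poly_linear_def Lie_density_def pderiv_add pderiv_smult algebra_simps smult_add_right)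

lemma cochain_codiff0: "poly_linear B \<Longrightarrow> cochain (codiff0 l m B)"
  using poly_linear_Lie_density[of m] poly_linear_Lie_density_vf[of m]
    poly_linear_Lie_density[of l] poly_linear_Lie_density_vf[of l]
  by (simp add: cochain_def poly_linear_def codiff0_def smult_diff_right)

section \<open>Cochains on monomials\<close>

lemma Lie_density_monom:
  "Lie_density l (monom 1 p) (monom 1 n) = smult (n + l * p) (monom 1 (n + p - 1))"
  by (cases p; cases n)
    (simp_all add: Lie_density_def pderiv_monom mult_monom smult_monom add_monom minus_monom algebra_simps)

lemma vf_bracket_monom:
  "vf_bracket (monom 1 p) (monom 1 q) = smult (real q - real p) (monom 1 (p + q - 1))"
  by (cases p; cases q)
    (simp_all add: vf_bracket_def pderiv_monom mult_monom smult_monom diff_monom minus_monom algebra_simps)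

lemma Lie_density_1: "Lie_density l (monom 1 0) f = pderiv f"
  by (simp add: Lie_density_def pderiv_monom monom_0 flip: one_pCons)

lemma coeff_0_Lie_density_monom:
  "p \<ge> 1 \<Longrightarrow> coeff (Lie_density m (monom 1 p) g) 0 = (if p = 1 then m * coeff g 0 else 0)"
  by (auto simp add: Lie_density_def pderiv_monom coeff_mult)

text \<open>Evaluation at 0 keeps, of the outer action of \<open>x^p\<close> with
  \<open>p \<ge> 1\<close>, only the factor \<open>m\<close> for \<open>p = 1\<close>. The cocycle
  condition thus becomes a system of linear recurrences for the numbers \<open>gam\<close>.\<close>

lemma gam_codiff1:
  assumes c: "cochain c" and "p \<ge> 1" "q \<ge> 1"
  shows "coeff (codiff1 l m c (monom 1 p) (monom 1 q) (monom 1 n)) 0 =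
     (if p = 1 then m * gam c q n else 0) - (n + l * p) * gam c q (n + p - 1)
     - ((if q = 1 then m * gam c p n else 0) - (n + l * q) * gam c p (n + q - 1))
     - (real q - real p) * gam c (p + q - 1) n"
  using assms(2,3)
  by (simp add: codiff1_def gam_def coeff_0_Lie_density_monom Lie_density_monom vf_bracket_monom
      poly_linear_smult[OF cochain_linear[OF c]] poly_linear_smult[OF cochain_linear_vf[OF c]])

lemma gam_codiff0:
  assumes B: "poly_linear B" and "q \<ge> 1"
  shows "gam (codiff0 l m B) q n = (if q = 1 then m * coeff (B (monom 1 n)) 0 else 0)
     - (n + l * q) * coeff (B (monom 1 (n + q - 1))) 0"
  using assms(2)
  by (simp add: codiff0_def gam_def coeff_0_Lie_density_monom Lie_density_monom
      poly_linear_smult[OF B])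

text \<open>The cocycle condition at the pair \<open>(1, X)\<close> gives
  \<open>(c X f)' = c X f' + c X' f\<close>. Hence every Taylor coefficient at 0 reduces to constant
  terms, and by bilinearity these are combinations of the numbers \<open>gam\<close>.\<close>

lemma cochain_eq_0_if_gam_eq_0:
  assumes c: "cochain c" and d: "\<And>X f. codiff1 l m c (monom 1 0) X f = 0"
    and c1: "\<And>f. c (monom 1 0) f = 0" and g: "\<And>q n. gam c q n = 0"
  shows "c X f = 0"
proof -
  have L: "\<And>X. poly_linear (c X)" "\<And>f. poly_linear (\<lambda>X. c X f)"
    using c by (simp_all add: cochain_def)
  have 0: "coeff (c X f) 0 = 0" for X f
  proof -
    have "c X f = (\<Sum>n\<le>degree f. \<Sum>q\<le>degree X.
        smult (coeff f n) (smult (coeff X q) (c (monom 1 q) (monom 1 n))))"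
      apply (subst poly_eq_sum_smult_monom[of X "degree X"], simp)
      apply (subst poly_eq_sum_smult_monom[of f "degree f"], simp)
      apply (simp only: poly_linear_sum[OF L(1)] poly_linear_sum[OF L(2)]
          poly_linear_smult[OF L(1)] poly_linear_smult[OF L(2)] smult_sum_right)
      done
    then show ?thesis using g by (simp add: coeff_sum gam_def)
  qed
  have "coeff (c X f) j = 0" for j X f
  proof (induction j arbitrary: X f)
    case (Suc j)
    have "vf_bracket (monom 1 0) X = pderiv X"
      by (simp add: vf_bracket_def pderiv_monom monom_0 flip: one_pCons)
    then have "pderiv (c X f) = c X (pderiv f) + c (pderiv X) f"
      using d[of X f] poly_linear_0[OF poly_linear_Lie_density]
      by (simp only: codiff1_def Lie_density_1 c1 diff_0_right diff_diff_eq right_minus_eq)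
    then have "coeff (pderiv (c X f)) j = 0" using Suc by simp
    then show ?case by (simp add: coeff_pderiv)
  qed (rule 0)
  then show ?thesis by (simp add: poly_eq_iff)
qed

section \<open>Commutators with the derivative\<close>

lemma ex_pderiv_eq:
  fixes p :: "real poly"
  shows "\<exists>q. pderiv q = p \<and> coeff q 0 = a"
proof -
  let ?q = "[:a:] + (\<Sum>n\<le>degree p. monom (coeff p n / (n + 1)) (Suc n))"
  have "coeff (monom (coeff p n / (n + 1)) (Suc n)) 0 = 0" for n by simp
  then have "coeff ?q 0 = a" by (simp add: coeff_sum)
  moreover have "pderiv ?q = (\<Sum>n\<le>degree p. monom (coeff p n) n)"
    by (simp add: pderiv_add poly_linear_sum[OF poly_linear_pderiv] pderiv_monom pderiv_pCons del: of_nat_Suc)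
  ultimately show ?thesis unfolding poly_as_sum_of_monoms by blast
qed

text \<open>\<open>B\<close> is built on monomials by solving
  \<open>(B x^n)' = P (x^n) + n B (x^(n-1))\<close> recursively. Each antiderivative leaves its
  constant term free, whence the arbitrary \<open>l\<close>.\<close>

lemma ex_commutator_pderiv_eq:
  fixes l :: "nat \<Rightarrow> real"
  assumes P: "poly_linear P"
  shows "\<exists>B. poly_linear B \<and> (\<forall>f. pderiv (B f) - B (pderiv f) = P f) \<and> (\<forall>n. coeff (B (monom 1 n)) 0 = l n)"
proof -
  obtain I :: "real poly \<Rightarrow> real \<Rightarrow> real poly"
    where I: "\<And>p a. pderiv (I p a) = p" "\<And>p a. coeff (I p a) 0 = a"
    using ex_pderiv_eq by metis
  define b where "b = rec_nat (I (P (monom 1 0)) (l 0))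
    (\<lambda>n y. I (P (monom 1 (Suc n)) + smult (Suc n) y) (l (Suc n)))"
  have b0: "b 0 = I (P (monom 1 0)) (l 0)"
    and bS: "b (Suc n) = I (P (monom 1 (Suc n)) + smult (Suc n) (b n)) (l (Suc n))" for n
    by (simp_all add: b_def)
  have coeff_b: "coeff (b n) 0 = l n" for n by (cases n) (simp_all add: b0 bS I)
  define B where "B f = (\<Sum>n\<le>degree f. smult (coeff f n) (b n))" for f
  \<comment> \<open>A common bound \<open>N\<close> allows the sums for \<open>f\<close>,
    \<open>g\<close> and \<open>f + g\<close> to be compared.\<close>
  have B: "B f = (\<Sum>n\<le>N. smult (coeff f n) (b n))" if "degree f \<le> N" for f N
    unfolding B_def using that
    by (intro sum.mono_neutral_left) (auto simp: coeff_eq_0)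
  have lin: "poly_linear B"
  proof (rule poly_linearI)
    fix f g :: "real poly"
    have "degree f \<le> max (degree f) (degree g)" "degree g \<le> max (degree f) (degree g)"
      "degree (f + g) \<le> max (degree f) (degree g)" by (simp_all add: degree_add_le_max)
    from this[THEN B] show "B (f + g) = B f + B g"
      by (simp only: coeff_add smult_add_left sum.distrib)
  next
    fix c f
    show "B (smult c f) = smult c (B f)"
      by (simp add: B_def smult_sum_right)
  qed
  have Bm: "B (monom 1 n) = b n" for n
  proof -
    have "B (monom 1 n) = (\<Sum>k\<le>n. smult (coeff (monom 1 n) k) (b k))" by (rule B) (simp add: degree_monom_le)
    also have "\<dots> = (\<Sum>k\<le>n. if k = n then b k else 0)" by (intro sum.cong) auto
    finally show ?thesis by simp
  qed
  have *: "pderiv (B (monom 1 n)) - B (pderiv (monom 1 n)) = P (monom 1 n)" for n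
  proof (cases n)
    case (Suc k)
    have "pderiv (monom (1::real) n) = smult (Suc k) (monom 1 k)"
      using Suc by (simp add: pderiv_monom smult_monom)
    then have "B (pderiv (monom 1 n)) = smult (Suc k) (b k)" by (simp only: poly_linear_smult[OF lin] Bm)
    then show ?thesis using Suc by (simp add: Bm bS I)
  next
    case 0
    have "pderiv (monom (1::real) 0) = 0" by (simp add: pderiv_monom)
    then show ?thesis using 0 by (simp only: Bm b0 I poly_linear_0[OF lin] diff_0_right)
  qed
  have "pderiv (B f) - B (pderiv f) = P f" for f
  proof -
    have f: "f = (\<Sum>n\<le>degree f. smult (coeff f n) (monom 1 n))"
      by (rule poly_eq_sum_smult_monom) simp
    have Q: "Q f = (\<Sum>n\<le>degree f. smult (coeff f n) (Q (monom 1 n)))" if "poly_linear Q" for Q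
    proof -
      have "Q f = Q (\<Sum>n\<le>degree f. smult (coeff f n) (monom 1 n))" using f by (rule arg_cong)
      then show ?thesis by (simp only: poly_linear_sum[OF that] poly_linear_smult[OF that])
    qed
    have "poly_linear (\<lambda>f. pderiv (B f) - B (pderiv f))"
      by (rule poly_linearI) (simp_all only: poly_linear_add[OF lin] poly_linear_smult[OF lin]
          pderiv_add pderiv_smult smult_diff_right add_diff_add)
    then have "pderiv (B f) - B (pderiv f)
        = (\<Sum>n\<le>degree f. smult (coeff f n) (pderiv (B (monom 1 n)) - B (pderiv (monom 1 n))))"
      by (rule Q)
    also have "\<dots> = P f" by (simp only: * Q[OF P])
    finally show ?thesis .
  qed
  moreover have "coeff (B (monom 1 n)) 0 = l n" for n by (simp only: Bm coeff_b)
  ultimately show ?thesis using lin by blast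
qed

text \<open>Scalars become constant polynomials, so that the cocycle identities are plain identities
  in a commutative ring.\<close>

lemma Lie_density_conv: "Lie_density l X f = X * pderiv f + [:l:] * (pderiv X * f)"
  by (simp add: Lie_density_def)

lemmas cocycle_simps = codiff1_def Lie_density_conv vf_bracket_def pderiv_add pderiv_diff pderiv_mult
  pderiv_singleton numeral_2_eq_2 numeral_3_eq_3

section \<open>The cocycles \<open>C0\<close>, \<open>C2\<close>, \<open>C3\<close> and the
  coboundaries\<close>

lemma codiff1_C0: "codiff1 l l C0 X Y f = 0"
  unfolding cocycle_simps C0_def by (simp add: algebra_simps del: mult_pCons_left mult_pCons_right)

lemma codiff1_C2: "codiff1 l (l + 2) C2 X Y f = 0"
proof -
  have [simp]: "[:l + 2:] = [:l:] + 1 + 1" by (simp add: one_pCons)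
  have C2: "C2 X f = pderiv (pderiv (pderiv X)) * f + (pderiv (pderiv X) * pderiv f + pderiv (pderiv X) * pderiv f)" for X f
    using smult_add_left[of 1 1 "pderiv (pderiv X) * pderiv f"]
    by (simp add: C2_def numeral_2_eq_2 numeral_3_eq_3)
  show ?thesis unfolding cocycle_simps C2 by (simp add: algebra_simps pderiv_add pderiv_mult del: mult_pCons_left mult_pCons_right)
qed

lemma codiff1_C3: "codiff1 l (l + 3) C3 X Y f = 0"
proof -
  have [simp]: "[:l + 3:] = [:l:] + 1 + 1 + 1" by (simp add: one_pCons)
  show ?thesis unfolding codiff1_def Lie_density_conv vf_bracket_def C3_def
  by (simp add: numeral_2_eq_2 numeral_3_eq_3 pderiv_add pderiv_diff pderiv_mult algebra_simps del: mult_pCons_left mult_pCons_right)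
qed

lemma cochain_C0: "cochain C0" and cochain_C2: "cochain C2" and cochain_C3: "cochain C3"
  by (simp_all add: cochain_def poly_linear_def C0_def C2_def C3_def higher_pderiv_add higher_pderiv_smult
      pderiv_add pderiv_smult distrib_left distrib_right smult_add_right mult.commute add_ac)

lemma C_monom_le_1:
  assumes "q \<le> 1"
  shows "C2 (monom 1 q) f = 0" "C3 (monom 1 q) f = 0"
proof -
  have "pderiv (pderiv (monom (1::real) q)) = 0"
    using assms by (cases "q = 0") (simp_all add: le_Suc_eq pderiv_monom)
  then show "C2 (monom 1 q) f = 0" "C3 (monom 1 q) f = 0" by (simp_all add: C2_def C3_def numeral_2_eq_2 numeral_3_eq_3)
qed

lemma gam_C:
  "gam C0 1 0 = 1" "gam C2 2 1 = 4" "gam C2 3 0 = 6" "gam C3 2 2 = 4" "gam C3 3 1 = 6"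
  by (simp_all add: gam_def C0_def C2_def C3_def pderiv_monom coeff_mult numeral_eq_Suc)

lemma gam_C0: "n \<noteq> 0 \<Longrightarrow> gam C0 1 n = 0"
  by (simp add: gam_def C0_def pderiv_monom)

lemma Lie_density_bracket:
  "Lie_density l (vf_bracket X Y) f = Lie_density l X (Lie_density l Y f) - Lie_density l Y (Lie_density l X f)"
  unfolding Lie_density_conv vf_bracket_def
  by (simp add: pderiv_add pderiv_diff pderiv_mult algebra_simps del: mult_pCons_left mult_pCons_right)

text \<open>The terms in which \<open>B\<close> stands between two actions cancel in pairs, and the
  others cancel because the Lie derivative respects brackets.\<close>

lemma codiff1_codiff0:
  assumes "poly_linear B"
  shows "codiff1 l m (codiff0 l m B) X Y f = 0"
proof -
  show ?thesis
    by (simp add: codiff1_def codiff0_def Lie_density_bracket poly_linear_diff[OF assms]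
        poly_linear_diff[OF poly_linear_Lie_density])
qed

lemma codiff1_combination:
  "codiff1 l m (\<lambda>X f. c X f - smult t (C X f) - b X f) X Y f
    = codiff1 l m c X Y f - smult t (codiff1 l m C X Y f) - codiff1 l m b X Y f"
  by (simp add: codiff1_def poly_linear_diff[OF poly_linear_Lie_density]
      poly_linear_smult[OF poly_linear_Lie_density] smult_diff_right)

lemma cochain_combination:
  assumes "cochain c" "cochain C" "cochain b"
  shows "cochain (\<lambda>X f. c X f - smult t (C X f) - b X f)"
  using assms by (simp add: cochain_def poly_linear_def smult_add_right smult_diff_right mult.commute)

text \<open>The condition on \<open>B\<close> at translations leaves the values \<open>B x\<^sup>n (0)\<close> free. For \<open>n \<noteq> m - l\<close> they are
  used up by the condition at the Euler field, and \<open>s\<close> is the value for \<open>n = m - l\<close>.\<close>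

lemma ex_normalization:
  assumes c: "cochain c" and C: "cochain C"
    and dc: "\<And>X Y f. codiff1 l m c X Y f = 0" and dC: "\<And>X Y f. codiff1 l m C X Y f = 0"
    and C_1: "\<And>f. C (monom 1 0) f = 0" and gC: "\<And>n. real n \<noteq> m - l \<Longrightarrow> gam C 1 n = 0"
  obtains B c' where "poly_linear B" "\<And>X f. c' X f = c X f - smult t (C X f) - codiff0 l m B X f"
    "cochain c'" "\<And>X Y f. codiff1 l m c' X Y f = 0" "\<And>f. c' (monom 1 0) f = 0"
    "\<And>q n. q \<ge> 1 \<Longrightarrow> real n + real q \<noteq> m - l + 1 \<Longrightarrow> gam c' q n = 0"
    "\<And>n. real n = m - l \<Longrightarrow> gam c' 1 n = gam c 1 n - t * gam C 1 n"
    "\<And>q n. q \<ge> 2 \<Longrightarrow> real n + real q = m - l + 1 \<Longrightarrow> gam c' q n = gam c q n - t * gam C q n + (n + l * q) * s"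
proof -
  define b where "b n = (if real n = m - l then s else gam c 1 n / (m - l - n))" for n :: nat
  obtain B where B: "poly_linear B" and B1: "\<And>f. pderiv (B f) - B (pderiv f) = c (monom 1 0) f"
    and Bb: "\<And>n. coeff (B (monom 1 n)) 0 = b n"
    using ex_commutator_pderiv_eq[OF cochain_linear[OF c], of "monom 1 0" b] by auto
  define c' where "c' X f = c X f - smult t (C X f) - codiff0 l m B X f" for X f
  have c': "cochain c'"
    unfolding c'_def by (intro cochain_combination c C cochain_codiff0 B)
  have dc': "codiff1 l m c' X Y f = 0" for X Y f
    unfolding c'_def codiff1_combination by (simp add: dc dC codiff1_codiff0[OF B])
  have gam: "gam c' q n = gam c q n - t * gam C q n - gam (codiff0 l m B) q n" for q n
    by (simp add: gam_def c'_def)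
  have g1: "gam c' 1 n = (if real n = m - l then gam c 1 n - t * gam C 1 n else 0)" for n
  proof -
    have "gam (codiff0 l m B) 1 n = (m - l - n) * b n"
      by (simp add: gam_codiff0[OF B] Bb algebra_simps)
    then show ?thesis using gC[of n] by (simp add: gam b_def)
  qed
  have g0: "gam c' q n = 0" if "q \<ge> 1" "real n + real q \<noteq> m - l + 1" for q n
  proof (cases "q = 1")
    case True
    then show ?thesis using that g1[of n] by simp
  next
    case False
    then have q: "q \<ge> 2" using that by simp
    \<comment> \<open>Cocycle condition at the pair \<open>(x, x^q)\<close>: the Euler field acts by
      the weight, and the remaining term contains \<open>gam c' 1 (n + q - 1)\<close>, which is zero
      here by \<open>g1\<close>.\<close>
    have "(m - l - (n + q - 1)) * gam c' q n = 0"
      using gam_codiff1[OF c', of 1 q l m n] q that g1[of "n + q - 1"]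
      by (simp add: dc' of_nat_diff algebra_simps)
    then show ?thesis using that by auto
  qed
  show ?thesis
    apply (rule that[OF B c'_def c' dc' _ g0])
    subgoal by (simp only: c'_def C_1 codiff0_def Lie_density_1 B1 smult_0_right diff_0_right diff_self)
    subgoal by assumption
    subgoal by assumption
    subgoal for n using g1[of n] by simp
    subgoal for q n by (simp add: gam gam_codiff0[OF B] Bb b_def of_nat_diff)
    done
qed

text \<open>After normalization only the finitely many numbers \<open>gam c' q n\<close> with
  \<open>q + n = m - l + 1\<close> can survive, and there are none if \<open>m < l\<close>. The
  cocycle condition and the choice of \<open>s\<close> and \<open>t\<close> make all of them
  zero.\<close>

theorem density_H1:
  assumes c: "cochain c" and dc: "\<And>X Y f. codiff1 l m c X Y f = 0" and l: "l > 0"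
    and C: "(C = C0 \<and> m = l) \<or> (C = C2 \<and> m = l + 2) \<or> (C = C3 \<and> m = l + 3) \<or>
      (C = (\<lambda>X f. 0) \<and> (m < l \<or> m = l + 1))"
  shows "\<exists>t B. poly_linear B \<and> (\<forall>X f. c X f = smult t (C X f) + codiff0 l m B X f)"
proof -
  have le_1: "C0 (monom 1 0) f = 0" "C2 (monom 1 0) f = 0" "C3 (monom 1 0) f = 0"
    "gam C2 1 n = 0" "gam C3 1 n = 0" for f n
    using C_monom_le_1[of 0 f] C_monom_le_1[of 1] by (simp_all add: C0_def gam_def pderiv_monom)
  have 0: "cochain (\<lambda>X f. 0)" "codiff1 l m (\<lambda>X f. 0) X Y f = 0" for X Y f
    by (simp_all add: cochain_def poly_linear_def codiff1_def poly_linear_0[OF poly_linear_Lie_density])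
  have C': "cochain C" "\<And>X Y f. codiff1 l m C X Y f = 0" "\<And>f. C (monom 1 0) f = 0"
    "\<And>n. real n \<noteq> m - l \<Longrightarrow> gam C 1 n = 0"
  proof -
    from C consider "C = C0" "m = l" | "C = C2" "m = l + 2" | "C = C3" "m = l + 3" | "C = (\<lambda>X f. 0)"
      by blast
    then have "cochain C \<and> (\<forall>X Y f. codiff1 l m C X Y f = 0) \<and> (\<forall>f. C (monom 1 0) f = 0)
        \<and> (\<forall>n. real n \<noteq> m - l \<longrightarrow> gam C 1 n = 0)"
    proof cases
      case 1
      show ?thesis unfolding 1 using cochain_C0 codiff1_C0 le_1(1) gam_C0 by auto
    next
      case 2
      show ?thesis unfolding 2 using cochain_C2 codiff1_C2 le_1(2,4) by auto
    next
      case 3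
      show ?thesis unfolding 3 using cochain_C3 codiff1_C3 le_1(3,5) by auto
    next
      case 4
      show ?thesis unfolding 4 using 0 by (simp add: gam_def)
    qed
    then show "cochain C" "\<And>X Y f. codiff1 l m C X Y f = 0" "\<And>f. C (monom 1 0) f = 0"
      "\<And>n. real n \<noteq> m - l \<Longrightarrow> gam C 1 n = 0" by simp_all
  qed
  let ?a = "gam c 2 1" and ?b = "gam c 3 0" and ?d = "gam c 2 2" and ?e = "gam c 3 1"
  \<comment> \<open>In weights 2 and 3, \<open>s\<close> and \<open>t\<close> solve the two linear equations \<open>gam c' 2 (k - 1) = 0\<close> and
    \<open>gam c' 3 (k - 2) = 0\<close> (\<open>k = m - l\<close>), whose determinants are 6 and 8 for every \<open>l\<close>.\<close>
  define s where "s = (if C = C2 \<and> m = l + 2 then (2 * ?b - 3 * ?a) / 3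
    else if C = C3 \<and> m = l + 3 then (2 * ?e - 3 * ?d) / 4 else - gam c 2 0 / (2 * l))"
  \<comment> \<open>The last branches of \<open>s\<close> and \<open>t\<close> serve the weights 1
    and 0: they solve \<open>gam c' 2 0 = 0\<close> for \<open>m = l + 1\<close> and
    \<open>gam c' 1 0 = 0\<close> for \<open>C0\<close>.\<close>
  define t where "t = (if C = C2 \<and> m = l + 2 then (?a + (1 + 2 * l) * s) / 4
    else if C = C3 \<and> m = l + 3 then (?d + (2 + 2 * l) * s) / 4 else gam c 1 0)"
  obtain B c' where B: "poly_linear B" and c'_def: "\<And>X f. c' X f = c X f - smult t (C X f) - codiff0 l m B X f"
    and c': "cochain c'" and dc': "\<And>X Y f. codiff1 l m c' X Y f = 0" and c'1: "\<And>f. c' (monom 1 0) f = 0"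
    and g0: "\<And>q n. q \<ge> 1 \<Longrightarrow> real n + real q \<noteq> m - l + 1 \<Longrightarrow> gam c' q n = 0"
    and g1: "\<And>n. real n = m - l \<Longrightarrow> gam c' 1 n = gam c 1 n - t * gam C 1 n"
    and g2: "\<And>q n. q \<ge> 2 \<Longrightarrow> real n + real q = m - l + 1 \<Longrightarrow> gam c' q n = gam c q n - t * gam C q n + (n + l * q) * s"
    using ex_normalization[OF c C'(1) dc C'(2-4), of t s] by blast
  have rel: "(real k - n - real q + 1) * gam c' q n + (n + l * q) * gam c' 1 (n + q - 1) = 0"
    if "m = l + real k" "q \<ge> 2" for k q n
    using gam_codiff1[OF c', of 1 q l m n] that(2) unfolding dc' unfolding that(1) by (simp add: algebra_simps)
  \<comment> \<open>For \<open>q = 2\<close> and \<open>n = k - 1\<close> the coefficient of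
    \<open>gam c' q n\<close> in \<open>rel\<close> is zero, while the other one,
    \<open>k - 1 + 2 * l\<close>, is positive.\<close>
  have g3: "gam c' 1 k = 0" if "m = l + real k" "k > 0" for k
  proof -
    have "real (k - 1) + l * real 2 > 0" using l by (intro add_nonneg_pos) simp_all
    then show ?thesis using rel[OF that(1), of 2 "k - 1"] that(2) by (simp add: of_nat_diff)
  qed
  have "gam c' q n = 0" for q n
  proof (cases "q \<ge> 1 \<and> real n + real q = m - l + 1")
    case False
    then show ?thesis using g0[of q n] c'1 by (cases "q = 0") (auto simp: gam_def)
  next
    case True
    then consider (0) "q = 1" "n = 0" "C = C0" "m = l"
      | (1) k where "q = 1" "n = k" "k > 0" "m = l + real k"
      | (2) "q = 2" "n = 0" "C = (\<lambda>X f. 0)" "m = l + 1"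
      | (3) "q = 2" "n = 1" "C = C2" "m = l + 2"
      | (4) "q = 3" "n = 0" "C = C2" "m = l + 2"
      | (5) "q = 2" "n = 2" "C = C3" "m = l + 3"
      | (6) "q = 3" "n = 1" "C = C3" "m = l + 3"
      | (7) "q = 4" "n = 0" "C = C3" "m = l + 3"
    proof -
      have eq: "n + q = k + 1" if "m = l + real k" for k
        using True that by (simp flip: of_nat_eq_iff[where 'a = real])
      have nonneg: "real n \<ge> 0" "real q \<ge> 1" using True by simp_all
      have cases2: "q = 1 \<and> n = 1 \<or> q = 2 \<and> n = 0" if "n + q = 2"
        using that conjunct1[OF True] by presburger
      have cases3: "q = 1 \<and> n = 2 \<or> q = 2 \<and> n = 1 \<or> q = 3 \<and> n = 0" if "n + q = 3"
        using that conjunct1[OF True] by presburger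
      have cases4: "q = 1 \<and> n = 3 \<or> q = 2 \<and> n = 2 \<or> q = 3 \<and> n = 1 \<or> q = 4 \<and> n = 0" if "n + q = 4"
        using that conjunct1[OF True] by presburger
      from C consider "C = C0" "m = l" | "C = C2" "m = l + 2" | "C = C3" "m = l + 3"
        | "C = (\<lambda>X f. 0)" "m = l + 1" | "m < l"
        by blast
      then show thesis
      proof cases
        case 1
        then show thesis using eq[of 0] True that(1) by simp
      next
        case 2
        then show thesis using eq[of 2] cases3 that(2)[of 2] that(4,5) by auto
      next
        case 3
        then show thesis using eq[of 3] cases4 that(2)[of 3] that(6-8) by auto
      next
        case 4
        then show thesis using eq[of 1] cases2 that(2)[of 1] that(3) by auto
      next
        case 5
        then show thesis using True nonneg by linarith
      qed
    qed
    then show ?thesis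
    proof cases
      case 0
      then show ?thesis using g1[of 0] by (simp add: t_def gam_C[simplified])
    next
      case 1
      then show ?thesis using g3 by simp
    next
      case 2
      then show ?thesis using g2[of 2 0] l by (simp add: s_def gam_def)
    next
      case 3
      then show ?thesis using g2[of 2 1] l by (simp add: s_def t_def gam_C[simplified] field_simps)
    next
      case 4
      then show ?thesis using g2[of 3 0] l by (simp add: s_def t_def gam_C[simplified] field_simps)
    next
      case 5
      then show ?thesis using g2[of 2 2] l by (simp add: s_def t_def gam_C[simplified] field_simps)
    next
      case 6
      then show ?thesis using g2[of 3 1] l by (simp add: s_def t_def gam_C[simplified] field_simps)
    next
      case 7
      \<comment> \<open>No free number is left for \<open>gam c' 4 0\<close>; the cocycle condition
        at \<open>(x^2, x^3)\<close> expresses it by the two numbers that vanish by the choice of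
        \<open>s\<close> and \<open>t\<close>.\<close>
      have "gam c' 2 2 = 0" "gam c' 3 1 = 0"
        using 7 g2[of 2 2] g2[of 3 1] l by (simp_all add: s_def t_def gam_C[simplified] field_simps)
      then show ?thesis using gam_codiff1[OF c', of 2 3 l m 0] unfolding dc' by (simp add: 7(1,2))
    qed
  qed
  then have "c' X f = 0" for X f
    by (intro cochain_eq_0_if_gam_eq_0[OF c' dc' c'1])
  then show ?thesis using B c'_def by (metis diff_diff_eq right_minus_eq)
qed

text \<open>The coboundary at the pairs \<open>(x, x\<^sup>2)\<close> and \<open>(x, x\<^sup>3)\<close> involves only the number \<open>gam c 1 (m - l)\<close>,
  and the two resulting equations for it and \<open>t\<close> have a nonzero determinant.\<close>

theorem density_obstruction:
  assumes c: "cochain c" and l: "l > 0"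
    and dc: "\<And>X Y f. codiff1 l m c X Y f = smult t (C0 X (C Y f) - C0 Y (C X f))"
    and C: "(C = C2 \<and> m = l + 2) \<or> (C = C3 \<and> m = l + 3)"
  shows "t = 0"
proof -
  have rel: "(n + l * q) * gam c 1 (n + q - 1) = t * gam C q n"
    if "q \<ge> 2" "m = l + real (n + q - 1)" for q n
  proof -
    \<comment> \<open>At the Euler field \<open>C0\<close> is the identity, and \<open>C2\<close>
      and \<open>C3\<close> vanish.\<close>
    have "coeff (codiff1 l m c (monom 1 1) (monom 1 q) (monom 1 n)) 0 = t * gam C q n"
      using C C_monom_le_1[of 1] by (auto simp: dc gam_def C0_def pderiv_monom)
    then show ?thesis
      unfolding gam_codiff1[OF c order.refl le_trans[OF one_le_numeral that(1)]]
      using that by (simp add: of_nat_diff algebra_simps)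
  qed
  from C show ?thesis
  proof (elim disjE conjE)
    assume "C = C2" "m = l + 2"
    then have "(1 + 2 * l) * gam c 1 2 = t * 4" "3 * l * gam c 1 2 = t * 6"
      using rel[of 2 1] rel[of 3 0] by (simp_all add: gam_C[simplified] algebra_simps flip: numeral_2_eq_2 numeral_3_eq_3)
    then show "t = 0" by algebra
  next
    assume "C = C3" "m = l + 3"
    then have "(2 + 2 * l) * gam c 1 3 = t * 4" "(1 + 3 * l) * gam c 1 3 = t * 6"
      using rel[of 2 2] rel[of 3 1] by (simp_all add: gam_C[simplified] algebra_simps flip: numeral_2_eq_2 numeral_3_eq_3)
    then show "t = 0" by algebra
  qed
qed

section \<open>The algebra of endomorphisms of the module of symbols\<close>

lemma scaleS_nth [simp]: "scaleS c u $ i = smult c (u $ i)"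
  by (simp add: scaleS_def)

lemma scaleS_simps [simp]:
  "scaleS c (u + v) = scaleS c u + scaleS c v" "scaleS c (u - v) = scaleS c u - scaleS c v"
  "scaleS (c + d) u = scaleS c u + scaleS d u" "scaleS c (scaleS d u) = scaleS (c * d) u"
  "scaleS 1 u = u" "scaleS c 0 = 0" "scaleS c (- u) = - scaleS c u" "scaleS 0 u = 0"
  by (simp_all add: vec_eq_iff smult_add_right smult_add_left smult_diff_right)

text \<open>As elements of a real algebra, endomorphisms can be coefficients of formal power series;
  products, inverses and curvature then live in the noncommutative ring
  \<open>endo fps\<close>.\<close>

typedef endo = EndS
  morphisms app Endo
  by (auto simp: EndS_def)

setup_lifting type_definition_endo

lemma app_add: "app P (u + v) = app P u + app P v"
  using app[of P] by (simp add: EndS_def)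

lemma app_scaleS: "app P (scaleS c u) = scaleS c (app P u)"
  using app[of P] by (simp add: EndS_def)

instantiation endo :: real_algebra_1
begin

lift_definition zero_endo :: endo is "\<lambda>u. 0" by (simp add: EndS_def)
lift_definition one_endo :: endo is "\<lambda>u. u" by (simp add: EndS_def)
lift_definition plus_endo :: "endo \<Rightarrow> endo \<Rightarrow> endo" is "\<lambda>P Q u. P u + Q u"
  by (simp add: EndS_def add_ac)
lift_definition minus_endo :: "endo \<Rightarrow> endo \<Rightarrow> endo" is "\<lambda>P Q u. P u - Q u"
  by (simp add: EndS_def)
lift_definition uminus_endo :: "endo \<Rightarrow> endo" is "\<lambda>P u. - P u"
  by (simp add: EndS_def)
lift_definition times_endo :: "endo \<Rightarrow> endo \<Rightarrow> endo" is "\<lambda>P Q u. P (Q u)"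
  by (simp add: EndS_def)
lift_definition scaleR_endo :: "real \<Rightarrow> endo \<Rightarrow> endo" is "\<lambda>c P u. scaleS c (P u)"
  by (simp add: EndS_def mult.commute)

instance
proof
  have "app 0 (\<chi> i. 1) \<noteq> app 1 (\<chi> i. 1)"
    by (simp add: zero_endo.rep_eq one_endo.rep_eq vec_eq_iff)
  then show "(0 :: endo) \<noteq> 1" by auto
qed (transfer; simp add: EndS_def fun_eq_iff algebra_simps)+

end

lemmas app_simps [simp] = zero_endo.rep_eq one_endo.rep_eq plus_endo.rep_eq minus_endo.rep_eq
  uminus_endo.rep_eq times_endo.rep_eq scaleR_endo.rep_eq

lemma app_sum: "app (\<Sum>k\<in>I. P k) u = (\<Sum>k\<in>I. app (P k) u)"
  by (induction I rule: infinite_finite_induct) simp_all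

lemma endo_eqI: "(\<And>u. app P u = app Q u) \<Longrightarrow> P = Q"
  by (metis app_inject ext)

lemma UNIV_comp: "(UNIV :: comp set) = {W1, W2, W3, W4}"
  using comp.exhaust by auto

text \<open>A matrix entry: \<open>i\<close> is the target and \<open>j\<close> the source, the
  reverse of the order in \<open>ext0\<close>.\<close>

definition block :: "comp \<Rightarrow> comp \<Rightarrow> endo \<Rightarrow> real poly \<Rightarrow> real poly" where
  "block i j P f = app P (axis j f) $ i"

lemma scaleS_axis: "scaleS c (axis j f) = axis j (smult c f)"
  by (simp add: vec_eq_iff axis_def)

lemma axis_add: "axis j (f + g) = axis j f + axis j (g :: 'a :: monoid_add)"
  by (simp add: vec_eq_iff axis_def)

lemma poly_linear_block: "poly_linear (block i j P)"
  by (simp add: poly_linear_def block_def axis_add app_add app_scaleS flip: scaleS_axis)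

lemma block_simps [simp]:
  "block i j (P + Q) f = block i j P f + block i j Q f"
  "block i j (P - Q) f = block i j P f - block i j Q f"
  "block i j (c *\<^sub>R P) f = smult c (block i j P f)"
  "block i j 0 f = 0"
  by (simp_all add: block_def)

lemma block_sum: "block i j (\<Sum>k\<in>I. P k) f = (\<Sum>k\<in>I. block i j (P k) f)"
  by (simp add: block_def app_sum sum_component)

lemma app_eq_sum_block: "app P u $ i = (\<Sum>j\<in>UNIV. block i j P (u $ j))"
proof -
  have "u = axis W1 (u $ W1) + axis W2 (u $ W2) + axis W3 (u $ W3) + axis W4 (u $ W4)"
    unfolding vec_eq_iff by (rule allI, case_tac i) (simp_all add: axis_def)
  then have "app P u = app P (axis W1 (u $ W1) + axis W2 (u $ W2) + axis W3 (u $ W3) + axis W4 (u $ W4))"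
    by (rule arg_cong)
  then show ?thesis by (simp add: UNIV_comp app_add block_def add_ac)
qed

lemma endo_eq_block_iff: "P = Q \<longleftrightarrow> (\<forall>i j f. block i j P f = block i j Q f)"
  by (auto intro!: endo_eqI simp: vec_eq_iff app_eq_sum_block)

lemma block_mult: "block i j (P * Q) f = (\<Sum>k\<in>UNIV. block i k P (block k j Q f))"
proof -
  have "block i j (P * Q) f = app P (app Q (axis j f)) $ i" by (simp add: block_def)
  also have "\<dots> = (\<Sum>k\<in>UNIV. block i k P (app Q (axis j f) $ k))" by (rule app_eq_sum_block)
  finally show ?thesis by (simp only: block_def[of _ j Q])
qed

lemma ex_block_eq:
  assumes "\<And>i j. poly_linear (A i j)"
  shows "\<exists>P. \<forall>i j. block i j P = A i j"
proof -
  define F where "F u = (\<chi> i. \<Sum>j\<in>UNIV. A i j (u $ j))" for u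
  have F: "F \<in> EndS"
    by (simp add: EndS_def F_def vec_eq_iff poly_linear_add[OF assms] poly_linear_smult[OF assms]
        sum.distrib smult_sum_right)
  have "block i j (Endo F) f = A i j f" for i j f
  proof -
    have "block i j (Endo F) f = (\<Sum>k\<in>UNIV. A i k (axis j f $ k))"
      unfolding block_def Endo_inverse[OF F] F_def by simp
    also have "\<dots> = (\<Sum>k\<in>UNIV. if k = j then A i k f else 0)"
      by (intro sum.cong) (simp_all add: axis_def poly_linear_0[OF assms])
    finally show ?thesis by simp
  qed
  then show ?thesis by blast
qed

section \<open>Cohomology with values in the endomorphisms\<close>

definition vf_linear :: "(real poly \<Rightarrow> endo) \<Rightarrow> bool" where
  "vf_linear c \<longleftrightarrow> (\<forall>X Y. c (X + Y) = c X + c Y) \<and> (\<forall>r X. c (smult r X) = r *\<^sub>R c X)"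

definition LieE :: "real poly \<Rightarrow> endo" where
  "LieE X = Endo (Lie_S X)"

definition Lie1E :: "real ^ par \<Rightarrow> real poly \<Rightarrow> endo" where
  "Lie1E t X = Endo (Lie1 t X)"

lemma app_LieE: "app (LieE X) = Lie_S X"
  unfolding LieE_def
  by (rule Endo_inverse)
    (simp add: EndS_def Lie_S_def vec_eq_iff poly_linear_add[OF poly_linear_Lie_density]
      poly_linear_smult[OF poly_linear_Lie_density])

lemma app_Lie1E: "app (Lie1E t X) = Lie1 t X"
proof -
  have L: "poly_linear (C0 X)" "poly_linear (C2 X)" "poly_linear (C3 X)"
    by (intro cochain_linear cochain_C0 cochain_C2 cochain_C3)+
  show ?thesis
    unfolding Lie1E_def
    by (rule Endo_inverse)
      (simp add: EndS_def Lie1_def ext0_def vec_eq_iff L[THEN poly_linear_add] L[THEN poly_linear_smult]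
        smult_add_right algebra_simps)
qed

fun par_of :: "comp \<Rightarrow> comp \<Rightarrow> par" where
  "par_of W1 W1 = T11" | "par_of W3 W1 = T13" | "par_of W4 W1 = T14" | "par_of W2 W2 = T22"
| "par_of W4 W2 = T24" | "par_of W3 W3 = T33" | "par_of W4 W4 = T44" | "par_of _ _ = T11"

text \<open>The operators \<open>C_block i j\<close> map from \<open>j\<close> to \<open>i\<close>; where they are zero, the value of
  \<open>par_of i j\<close> is irrelevant.\<close>

definition C_block :: "comp \<Rightarrow> comp \<Rightarrow> real poly \<Rightarrow> real poly \<Rightarrow> real poly" where
  "C_block i j = (if i = j then C0 else if (i, j) \<in> {(W3, W1), (W4, W2)} then C2
     else if (i, j) = (W4, W1) then C3 else (\<lambda>X f. 0))"

lemma block_LieE: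
  "block i j (LieE X * P) f = Lie_density (weight i) X (block i j P f)"
  "block i j (P * LieE X) f = block i j P (Lie_density (weight j) X f)"
proof -
  show "block i j (LieE X * P) f = Lie_density (weight i) X (block i j P f)"
    by (simp add: block_def app_LieE Lie_S_def)
  have "Lie_S X (axis j f) = axis j (Lie_density (weight j) X f)"
    by (simp add: vec_eq_iff Lie_S_def axis_def poly_linear_0[OF poly_linear_Lie_density])
  then show "block i j (P * LieE X) f = block i j P (Lie_density (weight j) X f)"
    by (simp add: block_def app_LieE)
qed

lemma block_Lie1E: "block i j (Lie1E t X) f = smult (t $ par_of i j) (C_block i j X f)"
proof -
  have "C0 X 0 = 0" "C2 X 0 = 0" "C3 X 0 = 0"
    by (simp_all add: poly_linear_0[OF cochain_linear] cochain_C0 cochain_C2 cochain_C3)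
  then show ?thesis
    by (cases i; cases j) (simp_all add: block_def app_Lie1E Lie1_def ext0_def axis_def C_block_def)
qed

text \<open>The Chevalley-Eilenberg differential of a 1-cochain for the adjoint action of
  \<open>LieE\<close>.\<close>

definition codiffE :: "(real poly \<Rightarrow> endo) \<Rightarrow> real poly \<Rightarrow> real poly \<Rightarrow> endo" where
  "codiffE c X Y = LieE X * c Y - c Y * LieE X - (LieE Y * c X - c X * LieE Y) - c (vf_bracket X Y)"

lemma block_codiffE:
  "block i j (codiffE c X Y) f = codiff1 (weight j) (weight i) (\<lambda>X. block i j (c X)) X Y f"
  by (simp add: codiffE_def codiff1_def block_LieE)

lemma cochain_block: "vf_linear c \<Longrightarrow> cochain (\<lambda>X. block i j (c X))"
  by (auto simp: cochain_def poly_linear_block poly_linear_def vf_linear_def)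
     (use poly_linear_block in \<open>simp add: poly_linear_def\<close>)+

lemma C_block_cases:
  "(C_block i j = C0 \<and> weight i = weight j) \<or> (C_block i j = C2 \<and> weight i = weight j + 2)
    \<or> (C_block i j = C3 \<and> weight i = weight j + 3)
    \<or> (C_block i j = (\<lambda>X f. 0) \<and> (weight i < weight j \<or> weight i = weight j + 1))"
  by (cases i; cases j) (simp_all add: C_block_def)

lemma weight_pos: "weight i > 0"
  by (cases i) simp_all

text \<open>\<open>LieE\<close> is diagonal, so each block of \<open>c\<close> is a cocycle with
  values in maps of densities. The linear maps found for the blocks are put together to
  \<open>B\<close>, the scalars to \<open>t\<close>.\<close>

theorem endo_H1:
  assumes "vf_linear c" "\<And>X Y. codiffE c X Y = 0"
  shows "\<exists>t B. \<forall>X. c X = Lie1E t X + (LieE X * B - B * LieE X)"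
proof -
  have "\<exists>t B. poly_linear B \<and>
      (\<forall>X f. block i j (c X) f = smult t (C_block i j X f) + codiff0 (weight j) (weight i) B X f)" for i j
    by (rule density_H1[OF cochain_block[OF assms(1)] _ weight_pos C_block_cases])
      (simp add: assms(2) flip: block_codiffE)
  then obtain \<tau> A where A: "\<And>i j. poly_linear (A i j)" and
    c: "\<And>i j X f. block i j (c X) f = smult (\<tau> i j) (C_block i j X f) + codiff0 (weight j) (weight i) (A i j) X f"
    by metis
  obtain B where B: "\<And>i j. block i j B = A i j" using ex_block_eq[of A] A by blast
  define t :: "real ^ par" where "t = (\<chi> p. case p of T11 \<Rightarrow> \<tau> W1 W1 | T13 \<Rightarrow> \<tau> W3 W1 | T14 \<Rightarrow> \<tau> W4 W1
    | T22 \<Rightarrow> \<tau> W2 W2 | T24 \<Rightarrow> \<tau> W4 W2 | T33 \<Rightarrow> \<tau> W3 W3 | T44 \<Rightarrow> \<tau> W4 W4)"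
  have "smult (\<tau> i j) (C_block i j X f) = smult (t $ par_of i j) (C_block i j X f)" for i j X f
    by (cases i; cases j) (simp_all add: t_def C_block_def)
  then have "c X = Lie1E t X + (LieE X * B - B * LieE X)" for X
    by (simp add: endo_eq_block_iff c block_Lie1E block_LieE B codiff0_def)
  then show ?thesis by blast
qed

text \<open>Coefficient of one block in the commutator of two first-order terms. For
  \<open>a = b\<close> it is the parameter of the block times the difference of the two diagonal
  parameters.\<close>

definition obstruction :: "real ^ par \<Rightarrow> real ^ par \<Rightarrow> comp \<Rightarrow> comp \<Rightarrow> real" where
  "obstruction a b i j = a $ par_of i i * b $ par_of i j - a $ par_of i j * b $ par_of j j"

text \<open>No two off-diagonal operators can be composed, so one factor of each product is diagonal
  and hence a multiple of \<open>C0\<close>.\<close>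

lemma block_Lie1E_commutator:
  "block i j (Lie1E a X * Lie1E b Y - Lie1E a Y * Lie1E b X) f
    = smult (obstruction a b i j) (C0 X (C_block i j Y f) - C0 Y (C_block i j X f))"
proof -
  note L = cochain_C0 cochain_C2 cochain_C3
  \<comment> \<open>After antisymmetrization in \<open>X\<close> and \<open>Y\<close>, moving
    \<open>C0\<close> from the right to the left of \<open>C2\<close> or \<open>C3\<close> only
    changes the sign.\<close>
  have 2: "C2 X (C0 Y f) - C2 Y (C0 X f) = C0 Y (C2 X f) - C0 X (C2 Y f)"
    by (simp add: C0_def C2_def numeral_2_eq_2 numeral_3_eq_3 pderiv_mult pderiv_add smult_add_right algebra_simps)
  have 3: "C3 X (C0 Y f) - C3 Y (C0 X f) = C0 Y (C3 X f) - C0 X (C3 Y f)"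
    by (simp add: C0_def C3_def numeral_2_eq_2 numeral_3_eq_3 pderiv_mult pderiv_add algebra_simps)
  have 0: "C0 X (C0 Y f) = C0 Y (C0 X f)" by (simp add: C0_def)
  have *: "smult q C + smult p A - (smult q D + smult p B) = smult (p - q) (A - B)"
    if "C - D = B - A" for p q and A B C D :: "real poly"
    using arg_cong[OF that, of "smult q"] by (simp add: smult_diff_right smult_diff_left)
  show ?thesis
    by (cases i; cases j)
      (simp_all add: block_mult UNIV_comp block_Lie1E C_block_def obstruction_def *[OF 2] *[OF 3]
        L[THEN cochain_linear, THEN poly_linear_smult] L[THEN cochain_linear, THEN poly_linear_0] 0)
qed

text \<open>On the three off-diagonal blocks with nonzero \<open>C_block\<close>,
  \<open>density_obstruction\<close> forces the coefficients to vanish. On all other blocks the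
  right-hand side is zero by itself, because \<open>C_block\<close> is zero or equal to the
  commuting \<open>C0\<close>.\<close>

theorem endo_obstruction:
  assumes c: "vf_linear c"
    and dc: "\<And>X Y. codiffE c X Y = (\<Sum>k\<in>I. Lie1E (a k) X * Lie1E (b k) Y - Lie1E (a k) Y * Lie1E (b k) X)"
  shows "codiffE c X Y = 0"
    and "(i, j) \<in> {(W3, W1), (W4, W1), (W4, W2)} \<Longrightarrow> (\<Sum>k\<in>I. obstruction (a k) (b k) i j) = 0"
proof -
  have blk: "block i j (codiffE c X Y) f = smult (\<Sum>k\<in>I. obstruction (a k) (b k) i j)
      (C0 X (C_block i j Y f) - C0 Y (C_block i j X f))" for i j X Y f
    by (simp only: dc block_sum block_Lie1E_commutator smult_sum)
  show *: "(\<Sum>k\<in>I. obstruction (a k) (b k) i j) = 0" if "(i, j) \<in> {(W3, W1), (W4, W1), (W4, W2)}" for i j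
    by (rule density_obstruction[OF cochain_block[OF c] weight_pos, of j "weight i" i j _ "C_block i j"])
      (use blk that in \<open>auto simp: block_codiffE C_block_def\<close>)
  have "block i j (codiffE c X Y) f = 0" for i j f
  proof (cases "(i, j) \<in> {(W3, W1), (W4, W1), (W4, W2)}")
    case True
    then show ?thesis by (simp only: blk *) simp
  next
    case False
    then show ?thesis by (auto simp: blk C_block_def C0_def)
  qed
  then show "codiffE c X Y = 0" by (simp add: endo_eq_block_iff)
qed

section \<open>Homogeneous polynomial maps\<close>

text \<open>Common form of \<open>hom_poly_op\<close> and \<open>hom_poly_par\<close> for values in
  any real vector space, so that endomorphisms, parameters and pairs of them are treated at
  once.\<close>

definition hom_poly :: "(real ^ par) set \<Rightarrow> nat \<Rightarrow> (real ^ par \<Rightarrow> 'a :: real_vector) \<Rightarrow> bool" where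
  "hom_poly V m P \<longleftrightarrow> (\<exists>c. \<forall>t\<in>V. P t = (\<Sum>\<alpha>\<in>multi_indices m. par_monom \<alpha> t *\<^sub>R c \<alpha>))"

lemma finite_multi_indices: "finite (multi_indices m)"
proof (rule finite_subset)
  show "multi_indices m \<subseteq> Pi\<^sub>E UNIV (\<lambda>i. {..m})"
  proof
    fix \<alpha> assume "\<alpha> \<in> multi_indices m"
    then have "\<alpha> i \<le> m" for i
      using member_le_sum[of i UNIV \<alpha>] by (simp add: multi_indices_def)
    then show "\<alpha> \<in> Pi\<^sub>E UNIV (\<lambda>i. {..m})" by auto
  qed
qed (simp add: finite_PiE)

lemma hom_poly_cong: "hom_poly V m P \<Longrightarrow> (\<And>t. t \<in> V \<Longrightarrow> P t = Q t) \<Longrightarrow> hom_poly V m Q"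
  by (simp add: hom_poly_def)

lemma hom_poly_linear:
  assumes "hom_poly V m P" "linear f"
  shows "hom_poly V m (\<lambda>t. f (P t))"
proof -
  obtain c where "\<forall>t\<in>V. P t = (\<Sum>\<alpha>\<in>multi_indices m. par_monom \<alpha> t *\<^sub>R c \<alpha>)"
    using assms(1) by (auto simp: hom_poly_def)
  then have "\<forall>t\<in>V. f (P t) = (\<Sum>\<alpha>\<in>multi_indices m. par_monom \<alpha> t *\<^sub>R f (c \<alpha>))"
    by (simp add: linear_sum[OF assms(2)] linear_scale[OF assms(2)])
  then show ?thesis by (auto simp: hom_poly_def)
qed

lemma hom_poly_0: "hom_poly V m (\<lambda>t. 0)"
  unfolding hom_poly_def by (rule exI[of _ "\<lambda>_. 0"]) simp

lemma hom_poly_add: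
  assumes "hom_poly V m P" "hom_poly V m Q"
  shows "hom_poly V m (\<lambda>t. P t + Q t)"
proof -
  obtain c d where "\<forall>t\<in>V. P t = (\<Sum>\<alpha>\<in>multi_indices m. par_monom \<alpha> t *\<^sub>R c \<alpha>)"
    "\<forall>t\<in>V. Q t = (\<Sum>\<alpha>\<in>multi_indices m. par_monom \<alpha> t *\<^sub>R d \<alpha>)"
    using assms by (auto simp: hom_poly_def)
  then have "\<forall>t\<in>V. P t + Q t = (\<Sum>\<alpha>\<in>multi_indices m. par_monom \<alpha> t *\<^sub>R (c \<alpha> + d \<alpha>))"
    by (simp add: scaleR_add_right sum.distrib)
  then show ?thesis unfolding hom_poly_def by (intro exI)
qed

lemma linear_uminus: "linear (uminus :: 'a :: real_vector \<Rightarrow> 'a)"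
  by (rule linearI) simp_all

lemma hom_poly_diff: "hom_poly V m P \<Longrightarrow> hom_poly V m Q \<Longrightarrow> hom_poly V m (\<lambda>t. P t - Q t)"
  using hom_poly_add[OF _ hom_poly_linear[OF _ linear_uminus], of V m P Q] by simp

lemma hom_poly_sum:
  "(\<And>k. k \<in> I \<Longrightarrow> hom_poly V m (P k)) \<Longrightarrow> hom_poly V m (\<lambda>t. \<Sum>k\<in>I. P k t)"
  by (induction I rule: infinite_finite_induct) (simp_all add: hom_poly_0 hom_poly_add)

lemma hom_poly_monom:
  assumes "\<alpha> \<in> multi_indices m"
  shows "hom_poly V m (\<lambda>t. par_monom \<alpha> t *\<^sub>R c)"
proof -
  have "par_monom \<alpha> t *\<^sub>R c = (\<Sum>\<beta>\<in>multi_indices m. par_monom \<beta> t *\<^sub>R (if \<beta> = \<alpha> then c else 0))" for t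
    using assms by (simp add: if_distrib[of "scaleR _"] finite_multi_indices cong: if_cong)
  then show ?thesis unfolding hom_poly_def by (intro exI ballI)
qed

lemma hom_poly_mult:
  fixes P Q :: "real ^ par \<Rightarrow> 'a :: real_algebra"
  assumes "hom_poly V m P" "hom_poly V n Q"
  shows "hom_poly V (m + n) (\<lambda>t. P t * Q t)"
proof -
  obtain c d where c: "\<And>t. t \<in> V \<Longrightarrow> P t = (\<Sum>\<alpha>\<in>multi_indices m. par_monom \<alpha> t *\<^sub>R c \<alpha>)"
    and d: "\<And>t. t \<in> V \<Longrightarrow> Q t = (\<Sum>\<beta>\<in>multi_indices n. par_monom \<beta> t *\<^sub>R d \<beta>)"
    using assms unfolding hom_poly_def by blast
  have "hom_poly V (m + n) (\<lambda>t. \<Sum>\<alpha>\<in>multi_indices m. \<Sum>\<beta>\<in>multi_indices n.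
      par_monom (\<lambda>i. \<alpha> i + \<beta> i) t *\<^sub>R (c \<alpha> * d \<beta>))"
    by (intro hom_poly_sum hom_poly_monom) (simp add: multi_indices_def sum.distrib)
  then show ?thesis
    by (rule hom_poly_cong)
      (simp add: c d sum_product par_monom_def power_add prod.distrib mult.commute)
qed

lemma hom_poly_const: "hom_poly V 0 (\<lambda>t. c)"
  using hom_poly_monom[of "\<lambda>_. 0" 0 V c] by (simp add: multi_indices_def par_monom_def)

lemma hom_poly_id: "hom_poly V 1 (\<lambda>t. t)"
proof -
  have "hom_poly V 1 (\<lambda>t. \<Sum>i\<in>UNIV. par_monom (\<lambda>j. if j = i then 1 else 0) t *\<^sub>R axis i (1::real))"
    by (intro hom_poly_sum hom_poly_monom) (simp add: multi_indices_def)
  moreover have "par_monom (\<lambda>j. if j = i then 1 else 0) t = t $ i" for i t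
    by (simp add: par_monom_def if_distrib[of "power _"] cong: if_cong)
  moreover have "(\<Sum>i\<in>UNIV. t $ i *\<^sub>R axis i 1) = t" for t :: "real ^ par"
    by (simp add: vec_eq_iff sum_component axis_def if_distrib[of "(*) _"] cong: if_cong)
  ultimately show ?thesis by simp
qed

lemma hom_poly_op_imp_hom_poly:
  assumes "hom_poly_op W V m P" "W \<subseteq> EndS"
  shows "hom_poly V m (\<lambda>t. Endo (P t))" "t \<in> V \<Longrightarrow> app (Endo (P t)) = P t"
proof -
  obtain c where c: "\<And>\<alpha>. \<alpha> \<in> multi_indices m \<Longrightarrow> c \<alpha> \<in> EndS"
    and P: "\<And>t u. t \<in> V \<Longrightarrow> P t u = (\<Sum>\<alpha>\<in>multi_indices m. scaleS (par_monom \<alpha> t) (c \<alpha> u))"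
    using assms unfolding hom_poly_op_def by blast
  have *: "P t = app (\<Sum>\<alpha>\<in>multi_indices m. par_monom \<alpha> t *\<^sub>R Endo (c \<alpha>))" if "t \<in> V" for t
    using that by (simp add: fun_eq_iff P app_sum Endo_inverse c)
  then show "t \<in> V \<Longrightarrow> app (Endo (P t)) = P t" by (simp add: app_inverse)
  show "hom_poly V m (\<lambda>t. Endo (P t))"
    unfolding hom_poly_def by (rule exI[of _ "\<lambda>\<alpha>. Endo (c \<alpha>)"]) (simp add: * app_inverse)
qed

lemma hom_poly_op_app:
  assumes "hom_poly V m P"
  shows "hom_poly_op EndS V m (\<lambda>t. app (P t))"
proof -
  obtain c where "\<And>t. t \<in> V \<Longrightarrow> P t = (\<Sum>\<alpha>\<in>multi_indices m. par_monom \<alpha> t *\<^sub>R c \<alpha>)"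
    using assms by (auto simp: hom_poly_def)
  then show ?thesis
    unfolding hom_poly_op_def by (intro exI[of _ "\<lambda>\<alpha>. app (c \<alpha>)"]) (simp add: app app_sum)
qed

section \<open>A linear choice of cochains\<close>

lemma vf_linearD:
  assumes "vf_linear c"
  shows "c (X + Y) = c X + c Y" "c (smult r X) = r *\<^sub>R c X"
  using assms by (simp_all add: vf_linear_def)

lemma vf_linear_LieE: "vf_linear LieE" and vf_linear_Lie1E: "vf_linear (Lie1E t)"
proof -
  show "vf_linear LieE"
    using poly_linear_Lie_density_vf
    by (simp add: vf_linear_def app_LieE Lie_S_def vec_eq_iff poly_linear_def fun_eq_iff flip: app_inject)
  have "poly_linear (\<lambda>X. C_block i j X f)" for i j f
    using cochain_C0 cochain_C2 cochain_C3
    by (auto simp: C_block_def cochain_def) (auto simp: poly_linear_def)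
  then show "vf_linear (Lie1E t)"
    by (simp add: vf_linear_def endo_eq_block_iff block_Lie1E poly_linear_def smult_add_right mult.commute)
qed

lemma linear_Lie1E: "linear (\<lambda>t. Lie1E t X)"
  by (rule linearI) (simp_all add: endo_eq_block_iff block_Lie1E smult_add_left)

lemma vf_linear_coboundary: "vf_linear (\<lambda>X. LieE X * B - B * LieE X)"
  by (simp add: vf_linear_def vf_linearD[OF vf_linear_LieE] algebra_simps scaleR_diff_right)

lemma vf_linear_add: "vf_linear c \<Longrightarrow> vf_linear d \<Longrightarrow> vf_linear (\<lambda>X. c X + d X)"
  and vf_linear_diff: "vf_linear c \<Longrightarrow> vf_linear d \<Longrightarrow> vf_linear (\<lambda>X. c X - d X)"
  and vf_linear_mult_left: "vf_linear c \<Longrightarrow> vf_linear (\<lambda>X. P * c X)"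
  and vf_linear_mult_right: "vf_linear c \<Longrightarrow> vf_linear (\<lambda>X. c X * P)"
  by (simp_all add: vf_linear_def algebra_simps scaleR_diff_right)

lemma vf_linear_sum: "(\<And>k. k \<in> I \<Longrightarrow> vf_linear (c k)) \<Longrightarrow> vf_linear (\<lambda>X. \<Sum>k\<in>I. c k X)"
  by (induction I rule: infinite_finite_induct) (simp_all add: vf_linear_add, simp_all add: vf_linear_def)

lemma vf_linear_eq_sum:
  assumes "vf_linear c"
  shows "c X = (\<Sum>q\<le>degree X. coeff X q *\<^sub>R c (monom 1 q))"
proof -
  have 0: "c 0 = 0" using vf_linearD(2)[OF assms, of 0 0] by simp
  have "c (\<Sum>q\<in>I. smult (coeff X q) (monom 1 q)) = (\<Sum>q\<in>I. coeff X q *\<^sub>R c (monom 1 q))" for I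
    by (induction I rule: infinite_finite_induct) (simp_all add: 0 vf_linearD[OF assms])
  moreover have "c X = c (\<Sum>q\<le>degree X. smult (coeff X q) (monom 1 q))"
    by (rule arg_cong[of _ _ c], rule poly_eq_sum_smult_monom) simp
  ultimately show ?thesis by (rule trans[rotated])
qed

lemma codiffE_diff: "codiffE (\<lambda>X. c X - d X) X Y = codiffE c X Y - codiffE d X Y"
  by (simp add: codiffE_def algebra_simps)

lemma codiffE_add: "codiffE (\<lambda>X. c X + d X) X Y = codiffE c X Y + codiffE d X Y"
  by (simp add: codiffE_def algebra_simps)

lemma LieE_bracket: "LieE (vf_bracket X Y) = LieE X * LieE Y - LieE Y * LieE X"
  by (simp add: endo_eq_block_iff block_LieE Lie_density_bracket)
     (simp add: block_def app_LieE Lie_S_def axis_def Lie_density_bracket poly_linear_0[OF poly_linear_Lie_density])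

lemma codiffE_coboundary: "codiffE (\<lambda>X. LieE X * B - B * LieE X) X Y = 0"
  by (simp add: codiffE_def LieE_bracket algebra_simps)

lemma codiffE_Lie1E: "codiffE (Lie1E t) X Y = 0"
proof -
  have "codiff1 (weight j) (weight i) (C_block i j) X Y f = 0" for i j f
    using C_block_cases[of i j] codiff1_C0 codiff1_C2 codiff1_C3
    by (elim disjE conjE) (simp_all add: codiff1_def poly_linear_0[OF poly_linear_Lie_density])
  moreover have "codiff1 l m (\<lambda>X f. smult r (C X f)) X Y f = smult r (codiff1 l m C X Y f)" for l m r C f
    by (simp add: codiff1_def poly_linear_smult[OF poly_linear_Lie_density] smult_diff_right)
  ultimately show ?thesis by (simp add: endo_eq_block_iff block_codiffE block_Lie1E[abs_def])
qed

text \<open>The bracket of \<open>x^2\<close> and \<open>x^(q-1)\<close> is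
  \<open>(q-3) x^q\<close>, so beyond degree 3 the values follow by induction.\<close>

lemma cocycle_eq_0:
  assumes c: "vf_linear c" and dc: "\<And>X Y. codiffE c X Y = 0" and c0: "\<And>q. q \<le> 3 \<Longrightarrow> c (monom 1 q) = 0"
  shows "c X = 0"
proof -
  have "c (monom 1 q) = 0" for q
  proof (induction q rule: less_induct)
    case (less q)
    show ?case
    proof (cases "q \<le> 3")
      case False
      then have "c (vf_bracket (monom 1 2) (monom 1 (q - 1))) = 0"
        using dc[of "monom 1 2" "monom 1 (q - 1)"] less[of 2] less[of "q - 1"] by (simp add: codiffE_def)
      then show ?thesis
        using False by (simp add: vf_bracket_monom vf_linearD[OF c])
    qed (use c0 in simp)
  qed
  then show ?thesis by (subst vf_linear_eq_sum[OF c]) simp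
qed

text \<open>The vector fields \<open>1, x, x\<^sup>2, x\<^sup>3\<close> generate the Lie algebra, so these values determine a cocycle.\<close>

definition generator_values :: "(real poly \<Rightarrow> endo) \<Rightarrow> endo \<times> endo \<times> endo \<times> endo" where
  "generator_values c = (c (monom 1 0), c (monom 1 1), c (monom 1 2), c (monom 1 3))"

text \<open>The linearity of \<open>s\<close> is what makes the terms of the normalization homogeneous polynomials in
  the parameters.\<close>

lemma ex_linear_H1:
  obtains s :: "endo \<times> endo \<times> endo \<times> endo \<Rightarrow> (real ^ par) \<times> endo" where "linear s"
    "\<And>c X. vf_linear c \<Longrightarrow> (\<And>X Y. codiffE c X Y = 0) \<Longrightarrow>
      c X = Lie1E (fst (s (generator_values c))) X + (LieE X * snd (s (generator_values c)) - snd (s (generator_values c)) * LieE X)"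
proof -
  define T where "T p X = Lie1E (fst p) X + (LieE X * snd p - snd p * LieE X)" for p :: "(real ^ par) \<times> endo" and X
  have T: "vf_linear (T p)" "codiffE (T p) X Y = 0" for p X Y
  proof -
    show "vf_linear (T p)"
      unfolding T_def by (intro vf_linear_add vf_linear_coboundary vf_linear_Lie1E)
    show "codiffE (T p) X Y = 0"
      unfolding T_def codiffE_add codiffE_coboundary codiffE_Lie1E by simp
  qed
  have "linear (\<lambda>p. T p X)" for X
    by (rule linearI) (simp_all add: T_def linear_add[OF linear_Lie1E] linear_scale[OF linear_Lie1E]
        algebra_simps scaleR_diff_right)
  then have "linear (\<lambda>p. generator_values (T p))"
    by (auto simp: linear_iff generator_values_def)
  \<comment> \<open>A linear right inverse on the range of the generator values of the cocycles
    \<open>T p\<close>; by \<open>endo_H1\<close> the generator values of every cocycle lie in this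
    range.\<close>
  then obtain s where s: "linear s" "\<And>p. generator_values (T (s (generator_values (T p)))) = generator_values (T p)"
    using linear_exists_right_inverse_on[OF _ subspace_UNIV, of "\<lambda>p. generator_values (T p)"] by blast
  have "c X = T (s (generator_values c)) X" if c: "vf_linear c" "\<And>X Y. codiffE c X Y = 0" for c X
  proof -
    obtain p where "\<And>X. c X = T p X"
      using endo_H1[OF c] by (auto simp: T_def)
    then have p: "c = T p" by blast
    \<comment> \<open>The difference is a cocycle whose generator values are zero.\<close>
    have "T (s (generator_values c)) X - c X = 0"
    proof (rule cocycle_eq_0[of "\<lambda>X. T (s (generator_values c)) X - c X"])
      show "vf_linear (\<lambda>X. T (s (generator_values c)) X - c X)" by (intro vf_linear_diff T c)
      show "codiffE (\<lambda>X. T (s (generator_values c)) X - c X) X Y = 0" for X Y by (simp add: codiffE_diff T c)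
      show "T (s (generator_values c)) (monom 1 q) - c (monom 1 q) = 0" if "q \<le> 3" for q
      proof -
        have "q = 0 \<or> q = 1 \<or> q = 2 \<or> q = 3" using that by presburger
        then show ?thesis using s(2)[of p] unfolding p generator_values_def by (elim disjE) simp_all
      qed
    qed
    then show ?thesis by simp
  qed
  then show ?thesis using that[OF s(1)] unfolding T_def by blast
qed

section \<open>Normalization at a fixed value of the parameters\<close>

lemma fps_mult_nth_lowest:
  fixes A B :: "'a :: ring_1 fps"
  assumes "\<And>k. k < n \<Longrightarrow> fps_nth A k = 0"
  shows "fps_nth (A * B) n = fps_nth A n * fps_nth B 0" "fps_nth (B * A) n = fps_nth B 0 * fps_nth A n"
proof -
  have "fps_nth (A * B) n = (\<Sum>i=0..n. if i = n then fps_nth A n * fps_nth B 0 else 0)"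
    unfolding fps_mult_nth using assms by (intro sum.cong) auto
  then show "fps_nth (A * B) n = fps_nth A n * fps_nth B 0" by simp
  have "fps_nth (B * A) n = (\<Sum>i=0..n. if i = 0 then fps_nth B 0 * fps_nth A n else 0)"
    unfolding fps_mult_nth using assms by (intro sum.cong) auto
  then show "fps_nth (B * A) n = fps_nth B 0 * fps_nth A n" by simp
qed

text \<open>The deviation of \<open>E\<close> from a homomorphism of Lie algebras.\<close>

definition curvature :: "(real poly \<Rightarrow> endo fps) \<Rightarrow> real poly \<Rightarrow> real poly \<Rightarrow> endo fps" where
  "curvature E X Y = E X * E Y - E Y * E X - E (vf_bracket X Y)"

text \<open>The parameters are fixed here: \<open>\<phi>\<close> lists the values of the homogeneous
  parts, and the degree becomes the exponent of the series variable.\<close>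

definition inf_series :: "(nat \<Rightarrow> real ^ par) \<Rightarrow> real poly \<Rightarrow> endo fps" where
  "inf_series \<phi> X = Abs_fps (\<lambda>k. if k = 0 then LieE X else Lie1E (\<phi> k) X)"

text \<open>The terms without \<open>\<phi>\<close> cancel because \<open>LieE\<close> respects
  brackets, the terms linear in \<open>\<phi>\<close> because the first-order operators are
  cocycles. Only the quadratic terms are left.\<close>

lemma curvature_inf_series:
  assumes "\<phi> 0 = 0"
  shows "fps_nth (curvature (inf_series \<phi>) X Y) n
    = (\<Sum>i=0..n. Lie1E (\<phi> i) X * Lie1E (\<phi> (n - i)) Y - Lie1E (\<phi> i) Y * Lie1E (\<phi> (n - i)) X)"
proof -
  define M where "M X = Abs_fps (\<lambda>k. Lie1E (\<phi> k) X)" for X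
  have E: "inf_series \<phi> X = fps_const (LieE X) + M X" for X
    by (simp add: inf_series_def M_def fps_eq_iff linear_0[OF linear_Lie1E] assms)
  have "curvature (inf_series \<phi>) X Y = M X * M Y - M Y * M X
      + (fps_const (LieE X) * fps_const (LieE Y) - fps_const (LieE Y) * fps_const (LieE X) - fps_const (LieE (vf_bracket X Y)))
      + (fps_const (LieE X) * M Y - M Y * fps_const (LieE X)
         - (fps_const (LieE Y) * M X - M X * fps_const (LieE Y)) - M (vf_bracket X Y))"
    unfolding curvature_def E by (simp add: algebra_simps)
  moreover have "fps_nth (fps_const (LieE X) * M Y - M Y * fps_const (LieE X)
         - (fps_const (LieE Y) * M X - M X * fps_const (LieE Y)) - M (vf_bracket X Y)) n = codiffE (Lie1E (\<phi> n)) X Y"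
    by (simp add: M_def codiffE_def)
  ultimately show ?thesis
    by (simp add: LieE_bracket codiffE_Lie1E fps_mult_nth M_def sum_subtractf flip: fps_const_mult fps_const_sub)
qed

text \<open>A Bianchi-type identity: \<open>curvature E * G\<close> equals
  \<open>G * curvature D\<close> plus terms linear in the error \<open>F = G * D - E * G\<close>. In
  degree \<open>n\<close> the other factors enter only through their constant terms \<open>1\<close>
  and \<open>LieE\<close>, which produces the codifferential.\<close>

lemma curvature_gauge:
  fixes G :: "endo fps" and D E :: "real poly \<Rightarrow> endo fps"
  assumes D: "curvature D X Y = 0"
    and D0: "\<And>X. fps_nth (D X) 0 = LieE X" and E0: "\<And>X. fps_nth (E X) 0 = LieE X" and G0: "fps_nth G 0 = 1"
    and F: "\<And>k X. k < n \<Longrightarrow> fps_nth (G * D X - E X * G) k = 0"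
    and K: "\<And>k. k < n \<Longrightarrow> fps_nth (curvature E X Y) k = 0"
  shows "codiffE (\<lambda>X. fps_nth (E X * G - G * D X) n) X Y = fps_nth (curvature E X Y) n"
proof -
  define F where "F X = G * D X - E X * G" for X
  have F': "k < n \<Longrightarrow> fps_nth (F X) k = 0" for k X using F by (simp add: F_def)
  have "curvature E X Y * G = G * curvature D X Y
      + (F (vf_bracket X Y) - F X * D Y - E X * F Y + F Y * D X + E Y * F X)"
    by (simp add: curvature_def F_def algebra_simps)
  then have "fps_nth (curvature E X Y * G) n
      = fps_nth (F (vf_bracket X Y) - F X * D Y - E X * F Y + F Y * D X + E Y * F X) n"
    by (simp only: D mult_zero_right add_0)
  then have "fps_nth (curvature E X Y) n = fps_nth (F (vf_bracket X Y)) n - fps_nth (F X) n * LieE Y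
      - LieE X * fps_nth (F Y) n + fps_nth (F Y) n * LieE X + LieE Y * fps_nth (F X) n"
    by (simp add: fps_mult_nth_lowest(1)[OF K] fps_mult_nth_lowest[OF F'] G0 D0 E0)
  moreover have "fps_nth (E X * G - G * D X) n = - fps_nth (F X) n" for X by (simp add: F_def)
  ultimately show ?thesis by (simp add: codiffE_def)
qed

text \<open>The pair of the terms of degree \<open>n\<close> of \<open>\<phi>\<close> and \<open>G\<close>, obtained by applying \<open>s\<close> to the part of the term of
  degree \<open>n\<close> of \<open>G D - E G\<close> that contains only earlier terms.\<close>

function gauge_seq :: "(endo \<times> endo \<times> endo \<times> endo \<Rightarrow> (real ^ par) \<times> endo) \<Rightarrow> (real poly \<Rightarrow> nat \<Rightarrow> endo) \<Rightarrow>
    real ^ par \<Rightarrow> nat \<Rightarrow> (real ^ par) \<times> endo" where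
  "gauge_seq s d t n = (if n = 0 then (0, 1) else if n = 1 then (t, 0) else
     s (generator_values (\<lambda>X. (\<Sum>k\<in>{0..<n}. snd (gauge_seq s d t k) * d X (n - k))
       - (\<Sum>k\<in>{1..<n}. Lie1E (fst (gauge_seq s d t k)) X * snd (gauge_seq s d t (n - k))))))"
  by auto
termination by (relation "Wellfounded.measure (\<lambda>(s, d, t, n). n)") auto

declare gauge_seq.simps [simp del]

text \<open>In degree 1 no gauge term is needed, since the part of degree 1 of a deformation is
  already \<open>Lie1E t\<close>.\<close>

lemma gauge_0: "gauge_seq s d t 0 = (0, 1)" and gauge_1: "gauge_seq s d t 1 = (t, 0)"
  by (simp_all add: gauge_seq.simps)

text \<open>Error and curvature are handled in one induction: if both vanish below degree
  \<open>n\<close>, the codifferential of the error is the curvature in degree \<open>n\<close>.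
  Both are zero by \<open>endo_obstruction\<close>, and the choice made by \<open>s\<close> then
  removes the error.\<close>

lemma gauge_normalizes:
  assumes s: "\<And>c X. vf_linear c \<Longrightarrow> (\<And>X Y. codiffE c X Y = 0) \<Longrightarrow>
      c X = Lie1E (fst (s (generator_values c))) X
        + (LieE X * snd (s (generator_values c)) - snd (s (generator_values c)) * LieE X)"
    and d_lin: "\<And>n. vf_linear (\<lambda>X. d X n)" and d0: "\<And>X. d X 0 = LieE X" and d1: "\<And>X. d X 1 = Lie1E t X"
    and flat: "\<And>X Y. curvature (\<lambda>X. Abs_fps (d X)) X Y = 0"
  defines "G \<equiv> Abs_fps (\<lambda>n. snd (gauge_seq s d t n))" and "\<phi> \<equiv> (\<lambda>n. fst (gauge_seq s d t n))"
  shows "G * Abs_fps (d X) = inf_series \<phi> X * G"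
    and "(i, j) \<in> {(W3, W1), (W4, W1), (W4, W2)} \<Longrightarrow> (\<Sum>k=0..n. obstruction (\<phi> k) (\<phi> (n - k)) i j) = 0"
proof -
  define F where "F X = inf_series \<phi> X * G - G * Abs_fps (d X)" for X
  have \<phi>0: "\<phi> 0 = 0" and \<phi>1: "\<phi> 1 = t" and G0: "fps_nth G 0 = 1" and G1: "fps_nth G 1 = 0"
    by (simp_all only: \<phi>_def G_def gauge_0 gauge_1 fps_nth_Abs_fps fst_conv snd_conv)
  have E_lin: "vf_linear (\<lambda>X. fps_nth (inf_series \<phi> X) n)" for n
    by (cases "n = 0") (simp_all add: inf_series_def vf_linear_LieE vf_linear_Lie1E)
  have E0: "fps_nth (inf_series \<phi> X) 0 = LieE X" for X by (simp add: inf_series_def)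
  have F_lin: "vf_linear (\<lambda>X. fps_nth (F X) n)" for n
    unfolding F_def fps_sub_nth fps_mult_nth fps_nth_Abs_fps
    by (intro vf_linear_diff vf_linear_sum vf_linear_mult_left vf_linear_mult_right E_lin d_lin)
  have step: "codiffE (\<lambda>X. fps_nth (F X) n) X Y = (\<Sum>i=0..n. Lie1E (\<phi> i) X * Lie1E (\<phi> (n - i)) Y - Lie1E (\<phi> i) Y * Lie1E (\<phi> (n - i)) X)"
    if "\<And>k X. k < n \<Longrightarrow> fps_nth (F X) k = 0" "\<And>k X Y. k < n \<Longrightarrow> fps_nth (curvature (inf_series \<phi>) X Y) k = 0" for n X Y
    unfolding F_def curvature_inf_series[of \<phi>, OF \<phi>0, symmetric]
    by (rule curvature_gauge[OF flat _ _ G0])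
      (use that in \<open>simp_all add: F_def d0 E0\<close>)
  have main: "(\<forall>X. fps_nth (F X) n = 0) \<and> (\<forall>X Y. fps_nth (curvature (inf_series \<phi>) X Y) n = 0)" for n
  proof (induction n rule: less_induct)
    case (less n)
    have dF: "codiffE (\<lambda>X. fps_nth (F X) n) X Y = (\<Sum>i=0..n. Lie1E (\<phi> i) X * Lie1E (\<phi> (n - i)) Y - Lie1E (\<phi> i) Y * Lie1E (\<phi> (n - i)) X)" for X Y
      by (rule step) (use less in auto)
    have dF0: "codiffE (\<lambda>X. fps_nth (F X) n) X Y = 0" for X Y
      by (rule endo_obstruction(1)[OF F_lin dF])
    have "fps_nth (F X) n = 0" for X
    proof -
      consider "n = 0" | "n = 1" | "n \<ge> 2" by linarith
      then show ?thesis
      proof cases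
        case 1
        then show ?thesis by (simp add: F_def G0 d0 inf_series_def)
      next
        case 2
        then show ?thesis using G1 \<phi>1 d1 by (simp add: F_def G0 d0 inf_series_def)
      next
        case 3
        define R where "R X = (\<Sum>k\<in>{0..<n}. snd (gauge_seq s d t k) * d X (n - k))
          - (\<Sum>k\<in>{1..<n}. Lie1E (fst (gauge_seq s d t k)) X * snd (gauge_seq s d t (n - k)))" for X
        define B where "B = fps_nth G n"
        have step_n: "gauge_seq s d t n = s (generator_values R)"
          using 3 unfolding R_def by (subst gauge_seq.simps) simp
        have I: "{0..n} = insert n {0..<n}" "{0..n} = insert 0 (insert n {1..<n})" using 3 by auto
        \<comment> \<open>The new terms of degree \<open>n\<close> enter the error only through a
          first-order operator plus a coboundary; what is subtracted is \<open>R\<close>, known from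
          lower degrees.\<close>
        have FR: "fps_nth (F X) n = (Lie1E (\<phi> n) X + (LieE X * B - B * LieE X)) - R X" for X
        proof -
          have "fps_nth (G * Abs_fps (d X)) n = B * LieE X + (\<Sum>k\<in>{0..<n}. snd (gauge_seq s d t k) * d X (n - k))"
            unfolding fps_mult_nth I(1) by (simp add: G_def B_def d0)
          moreover have "fps_nth (inf_series \<phi> X * G) n = LieE X * B + (Lie1E (\<phi> n) X
              + (\<Sum>k\<in>{1..<n}. Lie1E (fst (gauge_seq s d t k)) X * snd (gauge_seq s d t (n - k))))"
          proof -
            have "(\<Sum>k\<in>{1..<n}. fps_nth (inf_series \<phi> X) k * fps_nth G (n - k))
                = (\<Sum>k\<in>{1..<n}. Lie1E (fst (gauge_seq s d t k)) X * snd (gauge_seq s d t (n - k)))"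
              by (intro sum.cong) (simp_all add: inf_series_def \<phi>_def G_def)
            then show ?thesis
              unfolding fps_mult_nth I(2) using 3 G0 by (simp add: inf_series_def B_def)
          qed
          ultimately show ?thesis by (simp add: F_def R_def)
        qed
        have R: "R = (\<lambda>X. (Lie1E (\<phi> n) X + (LieE X * B - B * LieE X)) - fps_nth (F X) n)"
          by (simp add: FR)
        \<comment> \<open>\<open>R\<close> is a cocycle, because the error and the two other terms
          are, and so \<open>s\<close> applies to it.\<close>
        have "R X = Lie1E (fst (s (generator_values R))) X
            + (LieE X * snd (s (generator_values R)) - snd (s (generator_values R)) * LieE X)"
        proof (rule s)
          show "vf_linear R"
            unfolding R by (intro vf_linear_diff[OF vf_linear_add] vf_linear_Lie1E vf_linear_coboundary F_lin)
          show "codiffE R X Y = 0" for X Y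
            unfolding R codiffE_diff[where d = "\<lambda>X. fps_nth (F X) n"] codiffE_add codiffE_Lie1E codiffE_coboundary dF0 by simp
        qed
        then show ?thesis by (simp add: FR \<phi>_def B_def G_def step_n)
      qed
    qed
    moreover have "fps_nth (curvature (inf_series \<phi>) X Y) n = 0" for X Y
      using dF0 dF by (simp add: curvature_inf_series[of \<phi>, OF \<phi>0])
    ultimately show ?case by blast
  qed
  then show "G * Abs_fps (d X) = inf_series \<phi> X * G"
    by (simp add: F_def fps_eq_iff)
  show "(\<Sum>k=0..n. obstruction (\<phi> k) (\<phi> (n - k)) i j) = 0"
    if "(i, j) \<in> {(W3, W1), (W4, W1), (W4, W2)}"
    by (rule endo_obstruction(2)[OF F_lin[of n] _ that], rule step) (use main in auto)
qed

section \<open>The linear relations\<close>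

text \<open>Each Boolean records which factor of one of the three obstruction products is required
  to vanish, whence eight spaces.\<close>

definition rel_space :: "bool \<times> bool \<times> bool \<Rightarrow> (real ^ par) set" where
  "rel_space = (\<lambda>(a, b, c). {t. (if a then t $ T13 = 0 else t $ T11 = t $ T33)
     \<and> (if b then t $ T14 = 0 else t $ T11 = t $ T44) \<and> (if c then t $ T24 = 0 else t $ T22 = t $ T44)})"

text \<open>Linear coordinates on the space: \<open>w\<close> is the parameter \<open>T11\<close>,
  and \<open>x\<close>, \<open>y\<close>, \<open>z\<close> are, up to sign, the factors of the three
  products that stay free.\<close>

definition rel_point :: "bool \<times> bool \<times> bool \<Rightarrow> real \<times> real \<times> real \<times> real \<Rightarrow> real ^ par" where
  "rel_point = (\<lambda>(a, b, c) (w, x, y, z). \<chi> p. case p of T11 \<Rightarrow> w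
     | T13 \<Rightarrow> if a then 0 else x | T33 \<Rightarrow> if a then w + x else w
     | T14 \<Rightarrow> if b then 0 else y | T44 \<Rightarrow> if b then w + y else w
     | T24 \<Rightarrow> if c then 0 else z | T22 \<Rightarrow> (if b then w + y else w) + (if c then z else 0))"

lemma all_par: "(\<forall>p. P p) \<longleftrightarrow> P T11 \<and> P T13 \<and> P T14 \<and> P T22 \<and> P T24 \<and> P T33 \<and> P T44"
  by (metis par.exhaust)

lemma linear_rel_point: "linear (rel_point r)"
  by (cases r) (auto intro!: linearI simp: rel_point_def vec_eq_iff all_par algebra_simps)

lemma inj_rel_point: "inj (rel_point r)"
proof (rule injI)
  fix v v' assume "rel_point r v = rel_point r v'"
  then show "v = v'"
    by (cases r; cases v; cases v') (auto simp: rel_point_def vec_eq_iff all_par split: if_splits)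
qed

lemma range_rel_point: "range (rel_point r) = rel_space r"
proof
  show "range (rel_point r) \<subseteq> rel_space r"
    by (cases r) (auto simp: rel_point_def rel_space_def)
  show "rel_space r \<subseteq> range (rel_point r)"
  proof
    fix t assume t: "t \<in> rel_space r"
    obtain a b c where r: "r = (a, b, c)" by (cases r)
    have "t = rel_point r (t $ T11, if a then t $ T33 - t $ T11 else t $ T13,
        if b then t $ T44 - t $ T11 else t $ T14, if c then t $ T22 - t $ T44 else t $ T24)"
      using t by (auto simp: r rel_point_def rel_space_def vec_eq_iff all_par split: if_splits)
    then show "t \<in> range (rel_point r)" by blast
  qed
qed

lemma subspace_rel_space: "subspace (rel_space r)"
  using linear_subspace_image[OF linear_rel_point subspace_UNIV] by (simp add: range_rel_point)

lemma dim_rel_space: "dim (rel_space r) = 4"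
  using dim_image_eq[OF linear_rel_point, of r UNIV] inj_rel_point[of r]
  by (simp add: range_rel_point dim_UNIV)

text \<open>At this point the factors of the three products that are not required to vanish on
  \<open>rel_space r\<close> are nonzero.\<close>

lemma rel_point_mem_rel_space_iff: "rel_point r (0, 1, 1, 1) \<in> rel_space r' \<longleftrightarrow> r = r'"
  by (cases r; cases r') (auto simp: rel_point_def rel_space_def split: if_splits)

lemma inj_rel_space: "inj rel_space"
  by (metis injI rel_point_mem_rel_space_iff)

text \<open>A vector space is not the union of two proper subspaces: a point off one kernel plus a
  point off the other lies off both.\<close>

lemma product_of_linear_forms_eq_0:
  fixes f g :: "'a :: real_vector \<Rightarrow> real"
  assumes "subspace V" "linear f" "linear g" "\<And>t. t \<in> V \<Longrightarrow> f t * g t = 0"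
  shows "(\<forall>t\<in>V. f t = 0) \<or> (\<forall>t\<in>V. g t = 0)"
proof (rule ccontr)
  assume "\<not> ?thesis"
  then obtain a b where ab: "a \<in> V" "f a \<noteq> 0" "b \<in> V" "g b \<noteq> 0" by blast
  then have "g a = 0" "f b = 0" using assms(4) by auto
  moreover have "f (a + b) * g (a + b) = 0" using ab assms(1,4) by (simp add: subspace_add)
  ultimately show False using ab by (simp add: linear_add[OF assms(2)] linear_add[OF assms(3)])
qed

definition unobstructed :: "real ^ par \<Rightarrow> bool" where
  "unobstructed t \<longleftrightarrow> (\<forall>(i, j)\<in>{(W3, W1), (W4, W1), (W4, W2)}. obstruction t t i j = 0)"

lemma rel_space_unobstructed: "t \<in> rel_space r \<Longrightarrow> unobstructed t"
  by (cases r) (auto simp: rel_space_def unobstructed_def obstruction_def split: if_splits)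

lemma linear_coordinate: "linear (\<lambda>t :: real ^ par. t $ p)" "linear (\<lambda>t :: real ^ par. t $ p - t $ q)"
  by (auto intro!: linearI simp: algebra_simps)

text \<open>On \<open>V\<close> each obstruction product has an identically vanishing factor, so
  \<open>V\<close> lies in one of the eight spaces, and equality follows by dimension.\<close>

lemma unobstructed_subspace:
  assumes V: "subspace V" "dim V = 4" and "\<And>t. t \<in> V \<Longrightarrow> unobstructed t"
  shows "\<exists>r. V = rel_space r"
proof -
  have *: "(\<forall>t\<in>V. t $ p = 0) \<or> (\<forall>t\<in>V. t $ q - t $ q' = 0)" if "(p, q, q') \<in> {(T13, T11, T33), (T14, T11, T44), (T24, T22, T44)}" for p q q'
    by (rule product_of_linear_forms_eq_0[OF V(1) linear_coordinate])
      (use assms(3) that in \<open>force simp: unobstructed_def obstruction_def\<close>)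
  let ?r = "(\<forall>t\<in>V. t $ T13 = 0, \<forall>t\<in>V. t $ T14 = 0, \<forall>t\<in>V. t $ T24 = 0)"
  have "V \<subseteq> rel_space ?r"
    using *[of T13 T11 T33] *[of T14 T11 T44] *[of T24 T22 T44]
    unfolding rel_space_def right_minus_eq by simp blast
  then have "V = rel_space ?r"
    by (rule subspace_dim_equal[OF V(1) subspace_rel_space]) (simp add: V(2) dim_rel_space)
  then show ?thesis by blast
qed

text \<open>If \<open>g\<close> vanishes at \<open>t\<close>, move \<open>t\<close> along the line in the direction of \<open>t0\<close>.\<close>

lemma hom_poly_eq_0_dense:
  fixes p :: "real ^ par \<Rightarrow> real"
  assumes p: "hom_poly V m p" and V: "subspace V" and g: "linear g" "t0 \<in> V" "g t0 \<noteq> (0 :: real)"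
    and 0: "\<And>t. t \<in> V \<Longrightarrow> g t \<noteq> 0 \<Longrightarrow> p t = 0" and t: "t \<in> V"
  shows "p t = 0"
proof (cases "g t = 0")
  case True
  obtain c where c: "\<And>t. t \<in> V \<Longrightarrow> p t = (\<Sum>\<alpha>\<in>multi_indices m. par_monom \<alpha> t *\<^sub>R c \<alpha>)"
    using p unfolding hom_poly_def by blast
  define q where "q e = (\<Sum>\<alpha>\<in>multi_indices m. par_monom \<alpha> (t + e *\<^sub>R t0) *\<^sub>R c \<alpha>)" for e :: real
  have q: "q e = p (t + e *\<^sub>R t0)" for e
    unfolding q_def using V t g(2) by (subst c) (auto simp: subspace_add subspace_scale)
  have "isCont q 0"
    unfolding q_def par_monom_def by (intro continuous_intros)
  moreover have "q e = 0" if "e \<noteq> 0" for e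
    unfolding q using V t g(2,3) that True
    by (intro 0) (auto simp: subspace_add subspace_scale linear_add[OF g(1)] linear_scale[OF g(1)])
  then have "(q \<longlongrightarrow> 0) (at 0)"
    by (intro tendsto_eventually) (auto simp: eventually_at_filter)
  ultimately have "q 0 = 0"
    by (metis LIM_unique isCont_def)
  then show ?thesis by (simp add: q)
qed (use 0 t in blast)

text \<open>Where \<open>g t\<close> is nonzero, the series of the \<open>g (\<phi> n t)\<close> has
  a nonzero linear coefficient. Real power series have no zero divisors, so the other series
  vanishes there; \<open>hom_poly_eq_0_dense\<close> extends this to all of
  \<open>V\<close>.\<close>

lemma convolution_eq_0:
  fixes f g :: "real ^ par \<Rightarrow> real"
  assumes V: "subspace V" and f: "linear f" and g: "linear g"
    and \<phi>: "\<And>n. hom_poly V n (\<phi> n)" and \<phi>1: "\<And>t. t \<in> V \<Longrightarrow> \<phi> 1 t = t"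
    and conv: "\<And>t n. t \<in> V \<Longrightarrow> (\<Sum>k=0..n. f (\<phi> k t) * g (\<phi> (n - k) t)) = 0"
    and t0: "t0 \<in> V" "g t0 \<noteq> 0" and t: "t \<in> V"
  shows "f (\<phi> n t) = 0"
proof (rule hom_poly_eq_0_dense[OF hom_poly_linear[OF \<phi> f] V g t0 _ t])
  fix t assume t: "t \<in> V" "g t \<noteq> 0"
  have "Abs_fps (\<lambda>n. f (\<phi> n t)) * Abs_fps (\<lambda>n. g (\<phi> n t)) = 0"
    by (simp add: fps_eq_iff fps_mult_nth conv[OF t(1)])
  moreover have "fps_nth (Abs_fps (\<lambda>n. g (\<phi> n t))) 1 \<noteq> 0" using t by (simp add: \<phi>1[simplified])
  then have "Abs_fps (\<lambda>n. g (\<phi> n t)) \<noteq> 0" by (metis fps_zero_nth)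
  ultimately have "Abs_fps (\<lambda>n. f (\<phi> n t)) = 0" by simp
  then show "f (\<phi> n t) = 0" by (metis fps_nth_Abs_fps fps_zero_nth)
qed

text \<open>Each convolution has one factor whose linear term is not identically zero on the space.
  The other factor, the one required to vanish, therefore vanishes in every degree.\<close>

lemma parameters_in_rel_space:
  assumes \<phi>: "\<And>n. hom_poly (rel_space r) n (\<phi> n)" and \<phi>1: "\<And>t. t \<in> rel_space r \<Longrightarrow> \<phi> 1 t = t"
    and obs: "\<And>t i j n. t \<in> rel_space r \<Longrightarrow> (i, j) \<in> {(W3, W1), (W4, W1), (W4, W2)} \<Longrightarrow>
      (\<Sum>k=0..n. obstruction (\<phi> k t) (\<phi> (n - k) t) i j) = 0"
    and t: "t \<in> rel_space r"
  shows "\<phi> n t \<in> rel_space r"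
proof -
  let ?t0 = "rel_point r (0, 1, 1, 1)"
  have t0: "?t0 \<in> rel_space r" by (simp add: rel_point_mem_rel_space_iff)
  note conv = convolution_eq_0[OF subspace_rel_space _ _ \<phi> \<phi>1 _ t0 _ t]
  \<comment> \<open>Convolution is commutative; the obstruction sums contain the factors in both
    orders.\<close>
  have swap: "(\<Sum>k=0..n. f (\<phi> k t) * g (\<phi> (n - k) t)) = (\<Sum>k=0..n. g (\<phi> k t) * f (\<phi> (n - k) t))"
    for f g :: "real ^ par \<Rightarrow> real" and n t
    by (subst sum.atLeastAtMost_rev) (simp add: mult.commute)
  have o: "(\<Sum>k=0..n. \<phi> k t $ par_of i j * (\<phi> (n - k) t $ par_of i i - \<phi> (n - k) t $ par_of j j)) = 0"
    if "t \<in> rel_space r" "(i, j) \<in> {(W3, W1), (W4, W1), (W4, W2)}" for t i j n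
  proof -
    have "(\<Sum>k=0..n. \<phi> k t $ par_of i j * (\<phi> (n - k) t $ par_of i i - \<phi> (n - k) t $ par_of j j))
      = (\<Sum>k=0..n. obstruction (\<phi> k t) (\<phi> (n - k) t) i j)"
      using swap[where f = "\<lambda>x. x $ par_of i i" and g = "\<lambda>x. x $ par_of i j" and n = n and t = t]
      by (simp add: obstruction_def right_diff_distrib sum_subtractf)
    then show ?thesis using obs[OF that] by simp
  qed
  \<comment> \<open>The values at \<open>?t0\<close> decide which of \<open>A\<close> and
    \<open>B\<close> applies to each product.\<close>
  have A: "\<phi> n t $ par_of i j = 0"
    if "(i, j) \<in> {(W3, W1), (W4, W1), (W4, W2)}" "?t0 $ par_of i i - ?t0 $ par_of j j \<noteq> 0" for i j
    by (rule conv[OF linear_coordinate _ _ that(2)]) (auto intro: o[OF _ that(1)])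
  have B: "\<phi> n t $ par_of i i - \<phi> n t $ par_of j j = 0"
    if "(i, j) \<in> {(W3, W1), (W4, W1), (W4, W2)}" "?t0 $ par_of i j \<noteq> 0" for i j
    by (rule conv[OF linear_coordinate(2,1) _ _ that(2)])
      (auto intro: trans[OF swap[where f = "\<lambda>x. x $ par_of i i - x $ par_of j j"
            and g = "\<lambda>x. x $ par_of i j"] o[OF _ that(1)]])
  obtain a b c where r: "r = (a, b, c)" by (cases r)
  show ?thesis
    using A[of W3 W1] A[of W4 W1] A[of W4 W2] B[of W3 W1] B[of W4 W1] B[of W4 W2]
    by (simp add: r rel_space_def rel_point_def split: if_splits)
qed

section \<open>Formal deformations\<close>

lemma DiffS_subset_EndS: "DiffS \<subseteq> EndS"
proof
  fix P assume "P \<in> DiffS"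
  then obtain A where A: "\<And>i j. diff_op (A i j)" and P: "\<And>u. P u = (\<chi> i. \<Sum>j\<in>UNIV. A i j (u $ j))"
    by (auto simp: DiffS_def)
  have "poly_linear (A i j)" for i j
  proof -
    obtain n a where "A i j = (\<lambda>f. \<Sum>k\<le>n. a k * (pderiv ^^ k) f)"
      using A[of i j] by (auto simp: diff_op_def fun_eq_iff)
    then show ?thesis
      by (simp add: poly_linear_def higher_pderiv_add higher_pderiv_smult distrib_left sum.distrib smult_sum_right)
  qed
  then show "P \<in> EndS"
    by (simp add: EndS_def P vec_eq_iff poly_linear_add poly_linear_smult sum.distrib smult_sum_right)
qed

lemma diff_op_mult_pderiv: "diff_op (\<lambda>f. a * (pderiv ^^ k) f)"
proof -
  have "a * (pderiv ^^ k) f = (\<Sum>l\<le>k. (if l = k then a else 0) * (pderiv ^^ l) f)" for f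
    by (simp add: if_distrib[of "\<lambda>x. x * _"] cong: if_cong)
  then show ?thesis unfolding diff_op_def by (intro exI allI)
qed

lemma diff_op_add:
  assumes "diff_op P" "diff_op Q"
  shows "diff_op (\<lambda>f. P f + Q f)"
proof -
  obtain n a n' a' where P: "\<And>f. P f = (\<Sum>k\<le>n. a k * (pderiv ^^ k) f)" and Q: "\<And>f. Q f = (\<Sum>k\<le>n'. a' k * (pderiv ^^ k) f)"
    using assms unfolding diff_op_def by auto
  let ?N = "max n n'"
  have ext: "(\<Sum>k\<le>n. a k * F k) = (\<Sum>k\<le>?N. (if k \<le> n then a k else 0) * F k)"
    "(\<Sum>k\<le>n'. a' k * F k) = (\<Sum>k\<le>?N. (if k \<le> n' then a' k else 0) * F k)" for F :: "nat \<Rightarrow> real poly"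
    by (rule sum.mono_neutral_cong_left; auto)+
  have "P f + Q f = (\<Sum>k\<le>?N. ((if k \<le> n then a k else 0) + (if k \<le> n' then a' k else 0)) * (pderiv ^^ k) f)" for f
    unfolding P Q ext distrib_right sum.distrib ..
  then show ?thesis unfolding diff_op_def by (intro exI allI)
qed

lemma diff_op_smult:
  assumes "diff_op P"
  shows "diff_op (\<lambda>f. smult c (P f))"
proof -
  obtain n a where "\<And>f. P f = (\<Sum>k\<le>n. a k * (pderiv ^^ k) f)"
    using assms unfolding diff_op_def by auto
  then have "smult c (P f) = (\<Sum>k\<le>n. smult c (a k) * (pderiv ^^ k) f)" for f
    by (simp add: smult_sum_right)
  then show ?thesis unfolding diff_op_def by (intro exI allI)
qed

lemma app_mem_DiffS:
  assumes "\<And>i j. diff_op (block i j P)"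
  shows "app P \<in> DiffS"
  unfolding DiffS_def using assms
  by (intro CollectI exI[of _ "\<lambda>i j. block i j P"]) (simp add: vec_eq_iff app_eq_sum_block)

lemma diff_op_density:
  "diff_op (Lie_density l X)" "diff_op (C0 X)" "diff_op (C2 X)" "diff_op (C3 X)" "diff_op (\<lambda>f. 0)"
proof -
  note m = diff_op_mult_pderiv
  show "diff_op (Lie_density l X)"
    using diff_op_add[OF m[of X 1] m[of "smult l (pderiv X)" 0]] by (simp add: Lie_density_def[abs_def])
  show "diff_op (C0 X)" using m[of "pderiv X" 0] by (simp add: C0_def[abs_def])
  show "diff_op (C2 X)"
    using diff_op_add[OF m[of "(pderiv ^^ 3) X" 0] m[of "smult 2 ((pderiv ^^ 2) X)" 1]]
    by (simp add: C2_def[abs_def])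
  show "diff_op (C3 X)"
    using diff_op_add[OF m[of "(pderiv ^^ 3) X" 1] m[of "(pderiv ^^ 2) X" 2]] by (simp add: C3_def[abs_def])
  show "diff_op (\<lambda>f. 0)" using m[of 0 0] by simp
qed

lemma Lie_S_mem_DiffS: "Lie_S X \<in> DiffS" and Lie1_mem_DiffS: "Lie1 t X \<in> DiffS"
proof -
  have "block i j (LieE X) = (if i = j then Lie_density (weight i) X else (\<lambda>f. 0))" for i j
    by (auto simp: fun_eq_iff block_def app_LieE Lie_S_def axis_def poly_linear_0[OF poly_linear_Lie_density])
  then have "app (LieE X) \<in> DiffS" by (intro app_mem_DiffS) (simp add: diff_op_density)
  then show "Lie_S X \<in> DiffS" by (simp add: app_LieE)
  have "diff_op (block i j (Lie1E t X))" for i j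
    unfolding block_Lie1E[abs_def] by (rule diff_op_smult) (simp add: C_block_def diff_op_density)
  then have "app (Lie1E t X) \<in> DiffS" by (rule app_mem_DiffS)
  then show "Lie1 t X \<in> DiffS" by (simp add: app_Lie1E)
qed

section \<open>Operator series as power series of endomorphisms\<close>

lemma series_mult_app:
  assumes "\<And>n. P n t = app (fps_nth p n)" "\<And>n. Q n t = app (fps_nth q n)"
  shows "series_mult P Q n t = app (fps_nth (p * q) n)"
  by (simp add: fun_eq_iff series_mult_def assms fps_mult_nth app_sum atMost_atLeast0)

lemma infinitesimal_deformation_app:
  "infinitesimal_deformation \<phi> X n t = app (fps_nth (inf_series (\<lambda>k. \<phi> k t) X) n)"
  by (simp add: infinitesimal_deformation_def inf_series_def app_LieE app_Lie1E)

text \<open>The original parameters occur in degree 1 only, so the curvature is concentrated in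
  degree 2, where its blocks have the coefficients \<open>obstruction t t i j\<close>.\<close>

lemma curvature_unobstructed:
  assumes "unobstructed t"
  shows "curvature (inf_series (\<lambda>k. original_parameters k t)) X Y = 0"
proof -
  let ?p = "\<lambda>k. original_parameters k t"
  have *: "obstruction t t i j = 0 \<or> C_block i j = (\<lambda>X f. 0)" for i j
    using assms by (cases i; cases j) (simp_all add: unobstructed_def C_block_def obstruction_def)
  have 1: "smult (obstruction t t i j) (C0 X (C_block i j Y f) - C0 Y (C_block i j X f)) = 0" for i j f
    using *[of i j] by (elim disjE) (simp_all add: C0_def)
  have "obstruction 0 a i j = 0" "obstruction a 0 i j = 0" for a i j by (simp_all add: obstruction_def)
  with 1 have "smult (obstruction (?p k) (?p l) i j) (C0 X (C_block i j Y f) - C0 Y (C_block i j X f)) = 0" for k l i j f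
    by (simp add: original_parameters_def)
  then have "Lie1E (?p k) X * Lie1E (?p l) Y - Lie1E (?p k) Y * Lie1E (?p l) X = 0" for k l
    by (simp only: endo_eq_block_iff block_Lie1E_commutator block_simps(4) simp_thms)
  then show ?thesis
    by (simp add: fps_eq_iff curvature_inf_series original_parameters_def)
qed

lemma hom_poly_op_0: "hom_poly_op DiffS V m (\<lambda>t u. 0)"
proof -
  have "(\<lambda>u. 0) \<in> DiffS"
    using app_mem_DiffS[of 0] diff_op_density(5) by (simp add: block_simps(4)[abs_def] zero_endo.rep_eq[abs_def])
  then show ?thesis
    unfolding hom_poly_op_def by (intro exI[of _ "\<lambda>_ u. 0"]) simp
qed

text \<open>Parts of degree at least 2 vanish, linearity in the parameters supplies the coefficients
  in degree 1, and compatibility with brackets is the vanishing of the curvature.\<close>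

lemma formal_deformation_infinitesimal:
  assumes "\<And>t. t \<in> V \<Longrightarrow> unobstructed t"
  shows "formal_deformation V (infinitesimal_deformation original_parameters)"
proof -
  let ?D = "infinitesimal_deformation original_parameters"
  have "hom_poly_op DiffS V m (?D X m)" for X m
  proof -
    consider "m = 0" | "m = 1" | "m \<ge> 2" by linarith
    then show ?thesis
    proof cases
      case 1
      have "multi_indices 0 = {\<lambda>_. 0}" by (auto simp: multi_indices_def)
      then show ?thesis
        unfolding hom_poly_op_def using Lie_S_mem_DiffS
        by (intro exI[of _ "\<lambda>_. Lie_S X"]) (simp add: 1 infinitesimal_deformation_def par_monom_def)
    next
      case 2
      obtain c :: "(par \<Rightarrow> nat) \<Rightarrow> real ^ par" where "\<And>t. t = (\<Sum>\<alpha>\<in>multi_indices 1. par_monom \<alpha> t *\<^sub>R c \<alpha>)"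
        using hom_poly_id[of UNIV] by (auto simp: hom_poly_def)
      then have "Lie1E t X = Lie1E (\<Sum>\<alpha>\<in>multi_indices 1. par_monom \<alpha> t *\<^sub>R c \<alpha>) X" for t
        by (rule arg_cong[where f = "\<lambda>t. Lie1E t X"])
      then have "Lie1E t X = (\<Sum>\<alpha>\<in>multi_indices 1. par_monom \<alpha> t *\<^sub>R Lie1E (c \<alpha>) X)" for t
        by (rule trans) (simp only: linear_sum[OF linear_Lie1E] linear_scale[OF linear_Lie1E])
      from arg_cong[OF this, of "\<lambda>P. app P _"]
      have "app (Lie1E t X) u = app (\<Sum>\<alpha>\<in>multi_indices 1. par_monom \<alpha> t *\<^sub>R Lie1E (c \<alpha>) X) u" for t u .
      also have "app (\<Sum>\<alpha>\<in>multi_indices 1. par_monom \<alpha> t *\<^sub>R Lie1E (c \<alpha>) X) u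
          = (\<Sum>\<alpha>\<in>multi_indices 1. scaleS (par_monom \<alpha> t) (Lie1 (c \<alpha>) X u))" for t u
        by (simp only: app_Lie1E app_sum scaleR_endo.rep_eq)
      finally have "Lie1 t X u = (\<Sum>\<alpha>\<in>multi_indices 1. scaleS (par_monom \<alpha> t) (Lie1 (c \<alpha>) X u))" for t u
        unfolding app_Lie1E .
      note Lie1_eq = this
      have D: "?D X m t u = Lie1 t X u" for t u
        by (simp add: 2 infinitesimal_deformation_def original_parameters_def)
      show ?thesis
        unfolding hom_poly_op_def 2 D[unfolded 2]
        by (intro exI[of _ "\<lambda>\<alpha>. Lie1 (c \<alpha>) X"] conjI ballI allI Lie1_mem_DiffS Lie1_eq)
    next
      case 3
      have "?D X m = (\<lambda>t u. 0)"
        using 3 linear_0[OF linear_Lie1E]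
        by (simp add: fun_eq_iff infinitesimal_deformation_def original_parameters_def flip: app_Lie1E)
      then show ?thesis by (simp add: hom_poly_op_0)
    qed
  qed
  moreover have "?D (X + Y) m t u = ?D X m t u + ?D Y m t u" "?D (smult c X) m t u = scaleS c (?D X m t u)" for X Y m t u c
    by (simp_all add: infinitesimal_deformation_def vf_linearD[OF vf_linear_LieE] vf_linearD[OF vf_linear_Lie1E]
        flip: app_LieE app_Lie1E)
  moreover have "eq_on V (series_comm (?D X) (?D Y)) (?D (vf_bracket X Y))" for X Y
  proof -
    have "series_comm (?D X) (?D Y) m t u = ?D (vf_bracket X Y) m t u" if "t \<in> V" for m t u
    proof -
      let ?E = "inf_series (\<lambda>k. original_parameters k t)"
      have "fps_nth (?E X * ?E Y - ?E Y * ?E X) m = fps_nth (?E (vf_bracket X Y)) m"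
        using curvature_unobstructed[OF assms[OF that], of X Y] by (simp add: curvature_def)
      then have "app (fps_nth (?E X * ?E Y - ?E Y * ?E X) m) u = app (fps_nth (?E (vf_bracket X Y)) m) u"
        by (rule arg_cong)
      then show ?thesis
        by (simp add: series_comm_def series_mult_app[of "?D X" t "?E X" "?D Y" "?E Y"]
            series_mult_app[of "?D Y" t "?E Y" "?D X" "?E X"] infinitesimal_deformation_app)
    qed
    then show ?thesis by (simp add: eq_on_def fun_eq_iff)
  qed
  ultimately show ?thesis
    by (simp add: formal_deformation_def series_over_def)
       (simp add: infinitesimal_deformation_def original_parameters_def)
qed

section \<open>Normal form of a formal deformation\<close>

lemma hom_poly_Pair:
  fixes P :: "real ^ par \<Rightarrow> 'a :: real_vector" and Q :: "real ^ par \<Rightarrow> 'b :: real_vector"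
  assumes "hom_poly V m P" "hom_poly V m Q"
  shows "hom_poly V m (\<lambda>t. (P t, Q t))"
proof -
  have "linear (\<lambda>x :: 'a. (x, 0 :: 'b))" "linear (\<lambda>y :: 'b. (0 :: 'a, y))"
    by (auto intro!: linearI)
  then show ?thesis
    using hom_poly_add[OF hom_poly_linear[OF assms(1)] hom_poly_linear[OF assms(2)],
        of "\<lambda>x. (x, 0)" "\<lambda>y. (0, y)"] by simp
qed

text \<open>The recursion uses only products of terms whose degrees add up to \<open>n\<close>,
  sums, and linear maps such as \<open>s\<close>, all of which preserve homogeneity.\<close>

lemma hom_poly_gauge:
  assumes s: "linear s" and d: "\<And>X n. hom_poly V n (\<lambda>t. d X n t)"
  shows "hom_poly V n (\<lambda>t. gauge_seq s (\<lambda>X n. d X n t) t n)"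
proof (induction n rule: less_induct)
  case (less n)
  have fst: "hom_poly V k (\<lambda>t. fst (gauge_seq s (\<lambda>X n. d X n t) t k))" if "k < n" for k
    by (rule hom_poly_linear[OF less[OF that] linear_fst])
  have snd: "hom_poly V k (\<lambda>t. snd (gauge_seq s (\<lambda>X n. d X n t) t k))" if "k < n" for k
    by (rule hom_poly_linear[OF less[OF that] linear_snd])
  consider "n = 0" | "n = 1" | "n \<ge> 2" by linarith
  then show ?case
  proof cases
    case 1
    then show ?thesis by (simp add: gauge_0 hom_poly_const)
  next
    case 2
    then show ?thesis using hom_poly_Pair[OF hom_poly_id hom_poly_0] by (simp add: gauge_1[simplified])
  next
    case 3
    have "hom_poly V n (\<lambda>t. (\<Sum>k\<in>{0..<n}. snd (gauge_seq s (\<lambda>X n. d X n t) t k) * d X (n - k) t)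
       - (\<Sum>k\<in>{1..<n}. Lie1E (fst (gauge_seq s (\<lambda>X n. d X n t) t k)) X * snd (gauge_seq s (\<lambda>X n. d X n t) t (n - k))))" for X
    proof (intro hom_poly_diff hom_poly_sum)
      fix k assume k: "k \<in> {0..<n}"
      show "hom_poly V n (\<lambda>t. snd (gauge_seq s (\<lambda>X n. d X n t) t k) * d X (n - k) t)"
        using hom_poly_mult[OF snd d, of k "n - k"] k by simp
    next
      fix k assume k: "k \<in> {1..<n}"
      show "hom_poly V n (\<lambda>t. Lie1E (fst (gauge_seq s (\<lambda>X n. d X n t) t k)) X * snd (gauge_seq s (\<lambda>X n. d X n t) t (n - k)))"
        using hom_poly_mult[OF hom_poly_linear[OF fst linear_Lie1E] snd, of k "n - k"] k by simp
    qed
    then show ?thesis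
      using 3 by (subst gauge_seq.simps) (auto simp: generator_values_def intro!: hom_poly_linear[OF _ s] hom_poly_Pair)
  qed
qed

text \<open>The recursion for the coefficients of the inverse starts at \<open>1\<close> and
  involves only products whose degrees add up to \<open>n\<close>.\<close>

lemma hom_poly_right_inverse:
  assumes "\<And>n. hom_poly V n (G n)"
  shows "hom_poly V n (\<lambda>t. fps_nth (fps_right_inverse (Abs_fps (\<lambda>n. G n t)) 1) n :: endo)"
proof (induction n rule: less_induct)
  case (less n)
  show ?case
  proof (cases n)
    case 0
    then show ?thesis by (simp add: hom_poly_const)
  next
    case (Suc m)
    have "hom_poly V n (\<lambda>t. G k t * fps_nth (fps_right_inverse (Abs_fps (\<lambda>n. G n t)) 1) (n - k))" if "k \<in> {1..n}" for k
      using hom_poly_mult[OF assms less[of "n - k"], of k] that by simp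
    then have "hom_poly V n (\<lambda>t. - (\<Sum>k\<in>{1..n}. G k t * fps_nth (fps_right_inverse (Abs_fps (\<lambda>n. G n t)) 1) (n - k)))"
      by (intro hom_poly_linear[OF hom_poly_sum linear_uminus])
    then show ?thesis by (simp add: Suc)
  qed
qed

text \<open>The normalization is done for each \<open>t\<close> separately; the linearity of
  \<open>s\<close> makes the results homogeneous polynomials in \<open>t\<close>, so that they are
  series over \<open>V\<close>.\<close>

lemma formal_deformation_normal_form:
  assumes D: "formal_deformation V D"
  obtains G H :: "nat \<Rightarrow> real ^ par \<Rightarrow> endo" and \<phi> d where
    "\<And>n. hom_poly V n (G n)" "\<And>n. hom_poly V n (H n)" "\<And>n. hom_poly V n (\<phi> n)"
    "\<And>t. \<phi> 0 t = 0" "\<And>t. \<phi> 1 t = t"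
    "\<And>X n t. t \<in> V \<Longrightarrow> D X n t = app (fps_nth (d X t) n)"
    "\<And>t. Abs_fps (\<lambda>n. G n t) * Abs_fps (\<lambda>n. H n t) = 1" "\<And>t. Abs_fps (\<lambda>n. H n t) * Abs_fps (\<lambda>n. G n t) = 1"
    "\<And>X t. t \<in> V \<Longrightarrow> Abs_fps (\<lambda>n. G n t) * d X t = inf_series (\<lambda>n. \<phi> n t) X * Abs_fps (\<lambda>n. G n t)"
    "\<And>t i j n. t \<in> V \<Longrightarrow> (i, j) \<in> {(W3, W1), (W4, W1), (W4, W2)} \<Longrightarrow>
      (\<Sum>k=0..n. obstruction (\<phi> k t) (\<phi> (n - k) t) i j) = 0"
proof -
  define e where "e X n t = Endo (D X n t)" for X n t
  have "hom_poly_op DiffS V n (D X n)" for X n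
    using D by (auto simp: formal_deformation_def series_over_def)
  note * = hom_poly_op_imp_hom_poly[OF this DiffS_subset_EndS]
  have hom_e: "hom_poly V n (e X n)" for X n
    using *(1)[of n X] unfolding e_def .
  have app_e: "D X n t = app (e X n t)" if "t \<in> V" for X n t
    using *(2)[OF that] by (simp add: e_def)
  obtain s where s: "linear s" and s_H1: "\<And>c X. vf_linear c \<Longrightarrow> (\<And>X Y. codiffE c X Y = 0) \<Longrightarrow>
      c X = Lie1E (fst (s (generator_values c))) X + (LieE X * snd (s (generator_values c)) - snd (s (generator_values c)) * LieE X)"
    using ex_linear_H1 by blast
  define g where "g n t = gauge_seq s (\<lambda>X n. e X n t) t n" for n t
  define G \<phi> where "G n t = snd (g n t)" and "\<phi> n t = fst (g n t)" for n t
  define H where "H n t = fps_nth (fps_right_inverse (Abs_fps (\<lambda>n. G n t)) 1) n" for n t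
  have g: "hom_poly V n (g n)" for n
    using hom_poly_gauge[OF s hom_e] unfolding g_def .
  have G: "hom_poly V n (G n)" and \<phi>: "hom_poly V n (\<phi> n)" for n
    using hom_poly_linear[OF g linear_snd] hom_poly_linear[OF g linear_fst] unfolding G_def \<phi>_def by auto
  have H: "hom_poly V n (H n)" for n
    using hom_poly_right_inverse[of V G, OF G] unfolding H_def .
  have G0: "1 * fps_nth (Abs_fps (\<lambda>n. G n t)) 0 = 1" "fps_nth (Abs_fps (\<lambda>n. G n t)) 0 * 1 = 1" for t
    by (simp_all add: G_def g_def gauge_0)
  \<comment> \<open>Since the constant term of \<open>G\<close> is 1, its right inverse is also a
    left inverse; as \<open>endo\<close> is not commutative, both equations are recorded.\<close>
  have GH: "Abs_fps (\<lambda>n. G n t) * Abs_fps (\<lambda>n. H n t) = 1" "Abs_fps (\<lambda>n. H n t) * Abs_fps (\<lambda>n. G n t) = 1" for t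
    using fps_right_inverse[OF G0(2), of t] fps_left_inverse'[OF G0(1,2), of t] by (simp_all add: H_def fps_nth_inverse)
  have e: "vf_linear (\<lambda>X. e X n t)" "e X 0 t = LieE X" "e X 1 t = Lie1E t X"
    "curvature (\<lambda>X. Abs_fps (\<lambda>n. e X n t)) X Y = 0" if t: "t \<in> V" for t n X Y
  proof -
    have D': "D (X + Y) n t u = D X n t u + D Y n t u" "D (smult c X) n t u = scaleS c (D X n t u)"
      "D X 0 t = Lie_S X" "D X 1 t = Lie1 t X" "series_comm (D X) (D Y) n t = D (vf_bracket X Y) n t" for X Y n u c
      using D t unfolding formal_deformation_def eq_on_def by blast+
    show "vf_linear (\<lambda>X. e X n t)"
      using D'(1,2) by (auto simp: vf_linear_def app_e[OF t] intro!: endo_eqI)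
    show "e X 0 t = LieE X" "e X 1 t = Lie1E t X"
      using D'(3,4) by (simp_all add: app_e[OF t] app_inject flip: app_LieE app_Lie1E)
    have "fps_nth (Abs_fps (\<lambda>n. e X n t) * Abs_fps (\<lambda>n. e Y n t) - Abs_fps (\<lambda>n. e Y n t) * Abs_fps (\<lambda>n. e X n t)) n
        = e (vf_bracket X Y) n t" for n
      using D'(5)[of X Y n]
      by (intro endo_eqI) (simp add: series_comm_def app_e[OF t] fun_eq_iff
          series_mult_app[of "D X" t "Abs_fps (\<lambda>n. e X n t)" "D Y" "Abs_fps (\<lambda>n. e Y n t)"]
          series_mult_app[of "D Y" t "Abs_fps (\<lambda>n. e Y n t)" "D X" "Abs_fps (\<lambda>n. e X n t)"])
    then show "curvature (\<lambda>X. Abs_fps (\<lambda>n. e X n t)) X Y = 0"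
      by (simp add: curvature_def fps_eq_iff)
  qed
  note norm = gauge_normalizes[of s "\<lambda>X n. e X n t" t for t, OF s_H1 e, folded g_def, folded G_def \<phi>_def]
  show ?thesis
    by (rule that[of G H \<phi> "\<lambda>X t. Abs_fps (\<lambda>n. e X n t)", OF G H \<phi> _ _ _ GH norm])
      (simp_all add: app_e \<phi>_def g_def gauge_0 gauge_1[simplified])
qed

text \<open>In the obstruction sum of degree 2, \<open>\<phi> 0 t = 0\<close> and
  \<open>\<phi> 1 t = t\<close> leave the single term \<open>k = 1\<close>.\<close>

lemma formal_deformation_unobstructed:
  assumes "formal_deformation V D" "t \<in> V"
  shows "unobstructed t"
proof -
  obtain \<phi> :: "nat \<Rightarrow> real ^ par \<Rightarrow> real ^ par" where \<phi>: "\<And>t. \<phi> 0 t = 0" "\<And>t. \<phi> 1 t = t"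
    and obs: "\<And>t i j n. t \<in> V \<Longrightarrow> (i, j) \<in> {(W3, W1), (W4, W1), (W4, W2)} \<Longrightarrow>
      (\<Sum>k=0..n. obstruction (\<phi> k t) (\<phi> (n - k) t) i j) = 0"
    by (rule formal_deformation_normal_form[OF assms(1)]) blast
  have "(\<Sum>k=0..2. obstruction (\<phi> k t) (\<phi> (2 - k) t) i j) = obstruction t t i j" for i j
    using \<phi>(2) by (simp add: numeral_2_eq_2 \<phi>(1) obstruction_def)
  then show ?thesis
    unfolding unobstructed_def using obs[OF assms(2), of _ _ 2] by auto
qed

lemma formal_deformation_rel_space:
  "formal_deformation (rel_space r) (infinitesimal_deformation original_parameters)"
  by (rule formal_deformation_infinitesimal) (rule rel_space_unobstructed)

lemma four_parameter_relations_eq: "four_parameter_relations = range rel_space"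
proof -
  have "V \<in> range rel_space" if "V \<in> four_parameter_relations" for V
    using that unobstructed_subspace[of V] formal_deformation_unobstructed
    by (auto simp: four_parameter_relations_def)
  moreover have "rel_space r \<in> four_parameter_relations" for r
    unfolding four_parameter_relations_def
    by (intro CollectI conjI exI[of _ "infinitesimal_deformation original_parameters"] subspace_rel_space dim_rel_space formal_deformation_rel_space)
  ultimately show ?thesis by blast
qed

text \<open>Conjugation by \<open>G\<close>, with inverse \<open>H\<close>, is the required inner
  automorphism. The shape of the relations enters through \<open>parameters_in_rel_space\<close>, by
  which the new parameters satisfy the same relations.\<close>

lemma equivalent_to_infinitesimal:
  assumes "formal_deformation (rel_space r) D"
  shows "\<exists>\<phi>. parameter_system (rel_space r) \<phi> \<and>
    equivalent_deformations (rel_space r) D (infinitesimal_deformation \<phi>)"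
proof -
  let ?V = "rel_space r"
  obtain G H \<phi> d where G: "\<And>n. hom_poly ?V n (G n)" and H: "\<And>n. hom_poly ?V n (H n)" and \<phi>: "\<And>n. hom_poly ?V n (\<phi> n)"
    and \<phi>0: "\<And>t. \<phi> 0 t = 0" and \<phi>1: "\<And>t. \<phi> 1 t = t"
    and d: "\<And>X n t. t \<in> ?V \<Longrightarrow> D X n t = app (fps_nth (d X t) n)"
    and GH: "\<And>t. Abs_fps (\<lambda>n. G n t) * Abs_fps (\<lambda>n. H n t) = 1" "\<And>t. Abs_fps (\<lambda>n. H n t) * Abs_fps (\<lambda>n. G n t) = 1"
    and conj: "\<And>X t. t \<in> ?V \<Longrightarrow> Abs_fps (\<lambda>n. G n t) * d X t = inf_series (\<lambda>n. \<phi> n t) X * Abs_fps (\<lambda>n. G n t)"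
    and obs: "\<And>t i j n. t \<in> ?V \<Longrightarrow> (i, j) \<in> {(W3, W1), (W4, W1), (W4, W2)} \<Longrightarrow>
      (\<Sum>k=0..n. obstruction (\<phi> k t) (\<phi> (n - k) t) i j) = 0"
    using formal_deformation_normal_form[OF assms] by blast
  have "\<phi> n t \<in> ?V" if "t \<in> ?V" for n t
    by (rule parameters_in_rel_space[OF \<phi> \<phi>1 obs that])
  then have "parameter_system ?V \<phi>"
    using \<phi> by (simp add: parameter_system_def hom_poly_par_def hom_poly_def \<phi>0 \<phi>1[simplified])
  moreover
  define Gs Hs :: op_series where "Gs n t = app (G n t)" and "Hs n t = app (H n t)" for n t
  define \<Psi> where "\<Psi> P = series_mult Gs (series_mult P Hs)" for P
  have one: "series_one n t = app (fps_nth 1 n)" for n t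
    by (simp add: series_one_def fun_eq_iff)
  note GH_app = series_mult_app[of Gs _ "Abs_fps (\<lambda>n. G n _)" Hs "Abs_fps (\<lambda>n. H n _)"]
    series_mult_app[of Hs _ "Abs_fps (\<lambda>n. H n _)" Gs "Abs_fps (\<lambda>n. G n _)"]
  have GHs: "eq_on ?V (series_mult Gs Hs) series_one" "eq_on ?V (series_mult Hs Gs) series_one"
    by (simp_all add: eq_on_def one GH_app Gs_def Hs_def GH)
  have "Gs \<in> series_over EndS ?V" "Hs \<in> series_over EndS ?V"
    using hom_poly_op_app[OF G] hom_poly_op_app[OF H] by (simp_all add: series_over_def Gs_def[abs_def] Hs_def[abs_def])
  then have "inner_automorphism ?V \<Psi>"
    unfolding inner_automorphism_def using GHs by (auto simp: \<Psi>_def eq_on_def)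
  moreover have \<Psi>: "\<Psi> P n t = app (fps_nth (Abs_fps (\<lambda>n. G n t) * (p * Abs_fps (\<lambda>n. H n t))) n)"
    if "\<And>n. P n t = app (fps_nth p n)" for P n t p
    unfolding \<Psi>_def by (intro series_mult_app that) (simp_all add: Gs_def Hs_def)
  have "eq_on ?V (\<Psi> series_one) series_one"
    by (simp add: eq_on_def \<Psi>[OF one] GH one)
  moreover have "eq_on ?V (\<Psi> (D X)) (infinitesimal_deformation \<phi> X)" for X
  proof -
    have "\<Psi> (D X) n t = infinitesimal_deformation \<phi> X n t" if "t \<in> ?V" for n t
      unfolding \<Psi>[of "D X", OF d[OF that]] infinitesimal_deformation_app
      by (simp add: conj[OF that] mult.assoc GH flip: mult.assoc[of "Abs_fps (\<lambda>n. G n t)"])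
    then show ?thesis by (simp add: eq_on_def)
  qed
  ultimately show ?thesis
    unfolding equivalent_deformations_def by blast
qed

theorem proposition5p2:
  shows "card four_parameter_relations = 8
    \<and> (\<forall>V\<in>four_parameter_relations.
         formal_deformation V (infinitesimal_deformation original_parameters)
         \<and> (\<forall>D. formal_deformation V D \<longrightarrow>
              (\<exists>\<phi>. parameter_system V \<phi> \<and>
                   equivalent_deformations V D (infinitesimal_deformation \<phi>))))"
proof -
  have "card four_parameter_relations = card (UNIV :: (bool \<times> bool \<times> bool) set)"
    unfolding four_parameter_relations_eq by (rule card_image[OF inj_rel_space])
  also have "\<dots> = 8" by (simp flip: UNIV_Times_UNIV)
  finally show ?thesis
    using formal_deformation_rel_space equivalent_to_infinitesimal
    by (auto simp: four_parameter_relations_eq)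
qed

end
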